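(* Let $(H,K,\rightharpoonup,\leftharpoonup)$ be a matched pair of Hopf algebras and let $\pi:K\to H$ be a Hopf algebra homomorphism satisfying $$\pi(x_1\rightharpoonup a_1)(x_2\leftharpoonup a_2)=x\,\pi(a),\qquad\forall a\in K,\ x\in H.$$ Then the map $\pi:K\to H$ is a morphism of $(K,K,H)$-Doi-Hopf modules, where $H$ is a $(K,K,H)$-Doi-Hopf module with respect to the right $K$-action $\leftharpoonup$ and the left $H$-coaction $\Delta_H$, and $K$ is a $(K,K,H)$-Doi-Hopf module with respect to the right $K$-action $$a\leftharpoonup_\pi b=S_K(\pi(a_1)\rightharpoonup b_1)\,a_2b_2,\qquad a,b\in K,$$ and the left $H$-coaction $(\pi\otimes\mathrm{id}_K)\Delta_K$.
   Context: Everything is over a fixed arbitrary field $\mathbf{k}$; Sweedler notation $\Delta(x)=x_1\otimes x_2$; $S_K$ is the antipode of $K$. A matched pair of Hopf algebras $(H,K,\rightharpoonup,\leftharpoonup)$ consists of Hopf algebras $H,K$, a left $H$-module coalgebra action $\rightharpoonup:H\otimes K\to K$ on $K$ and a right $K$-module coalgebra action $\leftharpoonup:H\otimes K\to H$ on $H$ (so both maps are module actions and coalgebra maps) such that for all $x,y\in H$, $a,b\in K$: $x\rightharpoonup ab=(x_1\rightharpoonup a_1)((x_2\leftharpoonup a_2)\rightharpoonup b)$; $x\rightharpoonup 1_K=\varepsilon_H(x)1_K$; $xy\leftharpoonup a=(x\leftharpoonup(y_1\rightharpoonup a_1))(y_2\leftharpoonup a_2)$; $1_H\leftharpoonup a=\varepsilon_K(a)1_H$;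 $(x_1\rightharpoonup a_1)\otimes(x_2\leftharpoonup a_2)=(x_2\rightharpoonup a_2)\otimes(x_1\leftharpoonup a_1)$. Doi-Hopf modules: given a Hopf algebra $B$, a left $B$-comodule algebra $A$ (coaction $a\mapsto a_{-1}\otimes a_0\in B\otimes A$) and a right $B$-module coalgebra $C$ (action written $\leftharpoonup$), a (right-left) $(B,A,C)$-Doi-Hopf module $M$ is a right $A$-module $(M,\cdot)$ and a left $C$-comodule $(M,\rho)$, $\rho(m)=m_{-1}\otimes m_0\in C\otimes M$, such that $\rho(m\cdot a)=(m_{-1}\leftharpoonup a_{-1})\otimes(m_0\cdot a_0)$ for all $a\in A$, $m\in M$. A morphism of $(B,A,C)$-Doi-Hopf modules is a map that is right $A$-linear and left $C$-colinear. Here $B=A=K$, with $K$ a left $K$-comodule algebra via $\Delta_K$, and $C=H$ a right $K$-module coalgebra via $\leftharpoonup$. *)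

theory Defs
  imports Complex_Main "HOL-Library.Poly_Mapping"
begin

text \<open>
  Vector spaces over a field \<open>'f\<close> are types with a scalar multiplication satisfying the locale
  \<^locale>\<open>vector_space\<close>; the field itself is the vector space with scalar multiplication \<open>(*)\<close>.
  The class constraint \<open>{ring, monoid_mult}\<close> is that of unital rings, the zero ring included.
\<close>

definition bilinear_map ::
  "('f::field \<Rightarrow> 'a::ab_group_add \<Rightarrow> 'a) \<Rightarrow> ('f \<Rightarrow> 'b::ab_group_add \<Rightarrow> 'b) \<Rightarrow> ('f \<Rightarrow> 'c::ab_group_add \<Rightarrow> 'c)
    \<Rightarrow> ('a \<Rightarrow> 'b \<Rightarrow> 'c) \<Rightarrow> bool" where
  "bilinear_map sA sB sC f \<longleftrightarrow>
    (\<forall>a. Vector_Spaces.linear sB sC (f a)) \<and> (\<forall>b. Vector_Spaces.linear sA sC (\<lambda>a. f a b))"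


section \<open>Tensor products\<close>

text \<open>
  The tensor product of \<open>A\<close> and \<open>B\<close> is the free vector space on \<open>'a \<times> 'b\<close> modulo the span of the
  bilinearity relations. Its elements are the cosets, so \<open>u \<in> t\<close> says that the formal linear
  combination \<open>u\<close> of pairs represents the tensor \<open>t\<close>. The threefold tensor product is defined
  in the same way, by the trilinearity relations.
\<close>

type_synonym ('f, 'a, 'b) tensor = "('a \<times> 'b \<Rightarrow>\<^sub>0 'f) set"
type_synonym ('f, 'a, 'b, 'c) tensor3 = "('a \<times> 'b \<times> 'c \<Rightarrow>\<^sub>0 'f) set"

definition free_scale :: "'f::field \<Rightarrow> ('x \<Rightarrow>\<^sub>0 'f) \<Rightarrow> ('x \<Rightarrow>\<^sub>0 'f)" where
  "free_scale c u = Poly_Mapping.map (\<lambda>d. c * d) u"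

definition free_gen :: "'x \<Rightarrow> ('x \<Rightarrow>\<^sub>0 'f::field)" where
  "free_gen x = Poly_Mapping.single x 1"

text \<open>The linear map from the free vector space that sends the generator \<open>x\<close> to \<open>f x\<close>.\<close>

definition free_extend ::
  "('f::field \<Rightarrow> 'v::ab_group_add \<Rightarrow> 'v) \<Rightarrow> ('x \<Rightarrow> 'v) \<Rightarrow> ('x \<Rightarrow>\<^sub>0 'f) \<Rightarrow> 'v" where
  "free_extend s f u = (\<Sum>x \<in> Poly_Mapping.keys u. s (Poly_Mapping.lookup u x) (f x))"

definition tensor_relators ::
  "('f::field \<Rightarrow> 'a::ab_group_add \<Rightarrow> 'a) \<Rightarrow> ('f \<Rightarrow> 'b::ab_group_add \<Rightarrow> 'b) \<Rightarrow> ('a \<times> 'b \<Rightarrow>\<^sub>0 'f) set" where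
  "tensor_relators sA sB =
      {free_gen (a + a', b) - free_gen (a, b) - free_gen (a', b) | a a' b. True}
    \<union> {free_gen (a, b + b') - free_gen (a, b) - free_gen (a, b') | a b b'. True}
    \<union> {free_gen (sA c a, b) - free_scale c (free_gen (a, b)) | c a b. True}
    \<union> {free_gen (a, sB c b) - free_scale c (free_gen (a, b)) | c a b. True}"

definition tensor_class ::
  "('f::field \<Rightarrow> 'a::ab_group_add \<Rightarrow> 'a) \<Rightarrow> ('f \<Rightarrow> 'b::ab_group_add \<Rightarrow> 'b)
    \<Rightarrow> ('a \<times> 'b \<Rightarrow>\<^sub>0 'f) \<Rightarrow> ('f, 'a, 'b) tensor" where
  "tensor_class sA sB u = {v. v - u \<in> module.span free_scale (tensor_relators sA sB)}"

definition tensor ::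
  "('f::field \<Rightarrow> 'a::ab_group_add \<Rightarrow> 'a) \<Rightarrow> ('f \<Rightarrow> 'b::ab_group_add \<Rightarrow> 'b)
    \<Rightarrow> 'a \<Rightarrow> 'b \<Rightarrow> ('f, 'a, 'b) tensor" where
  "tensor sA sB a b = tensor_class sA sB (free_gen (a, b))"

definition tensor3_relators ::
  "('f::field \<Rightarrow> 'a::ab_group_add \<Rightarrow> 'a) \<Rightarrow> ('f \<Rightarrow> 'b::ab_group_add \<Rightarrow> 'b) \<Rightarrow> ('f \<Rightarrow> 'c::ab_group_add \<Rightarrow> 'c)
    \<Rightarrow> ('a \<times> 'b \<times> 'c \<Rightarrow>\<^sub>0 'f) set" where
  "tensor3_relators sA sB sC =
      {free_gen (a + a', b, c) - free_gen (a, b, c) - free_gen (a', b, c) | a a' b c. True}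
    \<union> {free_gen (a, b + b', c) - free_gen (a, b, c) - free_gen (a, b', c) | a b b' c. True}
    \<union> {free_gen (a, b, c + c') - free_gen (a, b, c) - free_gen (a, b, c') | a b c c'. True}
    \<union> {free_gen (sA r a, b, c) - free_scale r (free_gen (a, b, c)) | r a b c. True}
    \<union> {free_gen (a, sB r b, c) - free_scale r (free_gen (a, b, c)) | r a b c. True}
    \<union> {free_gen (a, b, sC r c) - free_scale r (free_gen (a, b, c)) | r a b c. True}"

definition tensor3_class ::
  "('f::field \<Rightarrow> 'a::ab_group_add \<Rightarrow> 'a) \<Rightarrow> ('f \<Rightarrow> 'b::ab_group_add \<Rightarrow> 'b) \<Rightarrow> ('f \<Rightarrow> 'c::ab_group_add \<Rightarrow> 'c)
    \<Rightarrow> ('a \<times> 'b \<times> 'c \<Rightarrow>\<^sub>0 'f) \<Rightarrow> ('f, 'a, 'b, 'c) tensor3" where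
  "tensor3_class sA sB sC u = {v. v - u \<in> module.span free_scale (tensor3_relators sA sB sC)}"

definition tensor3 ::
  "('f::field \<Rightarrow> 'a::ab_group_add \<Rightarrow> 'a) \<Rightarrow> ('f \<Rightarrow> 'b::ab_group_add \<Rightarrow> 'b) \<Rightarrow> ('f \<Rightarrow> 'c::ab_group_add \<Rightarrow> 'c)
    \<Rightarrow> 'a \<Rightarrow> 'b \<Rightarrow> 'c \<Rightarrow> ('f, 'a, 'b, 'c) tensor3" where
  "tensor3 sA sB sC a b c = tensor3_class sA sB sC (free_gen (a, b, c))"

definition tensor_rep :: "('x \<Rightarrow>\<^sub>0 'f::field) set \<Rightarrow> ('x \<Rightarrow>\<^sub>0 'f)" where
  "tensor_rep t = (SOME u. u \<in> t)"

definition linear_to_tensor ::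
  "('f::field \<Rightarrow> 'v::ab_group_add \<Rightarrow> 'v) \<Rightarrow> ('f \<Rightarrow> 'a::ab_group_add \<Rightarrow> 'a) \<Rightarrow> ('f \<Rightarrow> 'b::ab_group_add \<Rightarrow> 'b)
    \<Rightarrow> ('v \<Rightarrow> ('f, 'a, 'b) tensor) \<Rightarrow> bool" where
  "linear_to_tensor sV sA sB f \<longleftrightarrow>
      (\<forall>v. f v \<in> range (tensor_class sA sB))
    \<and> (\<forall>v w. f (v + w) = tensor_class sA sB (tensor_rep (f v) + tensor_rep (f w)))
    \<and> (\<forall>c v. f (sV c v) = tensor_class sA sB (free_scale c (tensor_rep (f v))))"

text \<open>
  Sweedler notation: for \<open>t = \<Sum>i. a\<^sub>i \<otimes> b\<^sub>i\<close>, the following three operations give \<open>\<Sum>i. f a\<^sub>i b\<^sub>i\<close>,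
  that is, they apply to \<open>t\<close> the linear map induced by the bilinear map \<open>f\<close> with values in a
  vector space, a tensor product and a threefold tensor product, respectively. Bilinearity of
  \<open>f\<close> makes the result independent of the chosen representatives.
\<close>

definition sweedler ::
  "('f::field \<Rightarrow> 'v::ab_group_add \<Rightarrow> 'v) \<Rightarrow> ('a \<Rightarrow> 'b \<Rightarrow> 'v) \<Rightarrow> ('f, 'a, 'b) tensor \<Rightarrow> 'v" where
  "sweedler sV f t = free_extend sV (\<lambda>(a, b). f a b) (tensor_rep t)"

definition sweedler_tensor ::
  "('f::field \<Rightarrow> 'c::ab_group_add \<Rightarrow> 'c) \<Rightarrow> ('f \<Rightarrow> 'd::ab_group_add \<Rightarrow> 'd)
    \<Rightarrow> ('a \<Rightarrow> 'b \<Rightarrow> ('f, 'c, 'd) tensor) \<Rightarrow> ('f, 'a, 'b) tensor \<Rightarrow> ('f, 'c, 'd) tensor" where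
  "sweedler_tensor sC sD f t =
    tensor_class sC sD (free_extend free_scale (\<lambda>(a, b). tensor_rep (f a b)) (tensor_rep t))"

definition sweedler_tensor3 ::
  "('f::field \<Rightarrow> 'c::ab_group_add \<Rightarrow> 'c) \<Rightarrow> ('f \<Rightarrow> 'd::ab_group_add \<Rightarrow> 'd) \<Rightarrow> ('f \<Rightarrow> 'e::ab_group_add \<Rightarrow> 'e)
    \<Rightarrow> ('a \<Rightarrow> 'b \<Rightarrow> ('f, 'c, 'd, 'e) tensor3) \<Rightarrow> ('f, 'a, 'b) tensor \<Rightarrow> ('f, 'c, 'd, 'e) tensor3" where
  "sweedler_tensor3 sC sD sE f t =
    tensor3_class sC sD sE (free_extend free_scale (\<lambda>(a, b). tensor_rep (f a b)) (tensor_rep t))"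

definition tensor_map ::
  "('f::field \<Rightarrow> 'c::ab_group_add \<Rightarrow> 'c) \<Rightarrow> ('f \<Rightarrow> 'd::ab_group_add \<Rightarrow> 'd)
    \<Rightarrow> ('a \<Rightarrow> 'c) \<Rightarrow> ('b \<Rightarrow> 'd) \<Rightarrow> ('f, 'a, 'b) tensor \<Rightarrow> ('f, 'c, 'd) tensor" where
  "tensor_map sC sD f g t = sweedler_tensor sC sD (\<lambda>a b. tensor sC sD (f a) (g b)) t"


section \<open>Algebras, coalgebras, Hopf algebras\<close>

locale unital_algebra = vector_space scale
  for scale :: "'f::field \<Rightarrow> 'a::{ring, monoid_mult} \<Rightarrow> 'a" +
  assumes scale_mult_left: "scale c x * y = scale c (x * y)"
    and scale_mult_right: "x * scale c y = scale c (x * y)"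

locale coalgebra = vector_space scale
  for scale :: "'f::field \<Rightarrow> 'a::ab_group_add \<Rightarrow> 'a" +
  fixes comult :: "'a \<Rightarrow> ('f, 'a, 'a) tensor" and counit :: "'a \<Rightarrow> 'f"
  assumes comult_linear: "linear_to_tensor scale scale scale comult"
    and counit_linear: "Vector_Spaces.linear scale (*) counit"
    and coassoc:
      "sweedler_tensor3 scale scale scale
          (\<lambda>x1 x2. sweedler_tensor3 scale scale scale
            (\<lambda>x11 x12. tensor3 scale scale scale x11 x12 x2) (comult x1)) (comult x)
        = sweedler_tensor3 scale scale scale
          (\<lambda>x1 x2. sweedler_tensor3 scale scale scale
            (\<lambda>x21 x22. tensor3 scale scale scale x1 x21 x22) (comult x2)) (comult x)"
    and counit_left: "sweedler scale (\<lambda>x1 x2. scale (counit x1) x2) (comult x) = x"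
    and counit_right: "sweedler scale (\<lambda>x1 x2. scale (counit x2) x1) (comult x) = x"

locale bialgebra = unital_algebra scale + coalgebra scale comult counit
  for scale :: "'f::field \<Rightarrow> 'a::{ring, monoid_mult} \<Rightarrow> 'a" and comult counit +
  assumes comult_mult:
      "comult (x * y) =
        sweedler_tensor scale scale (\<lambda>x1 x2. sweedler_tensor scale scale
          (\<lambda>y1 y2. tensor scale scale (x1 * y1) (x2 * y2)) (comult y)) (comult x)"
    and comult_one: "comult 1 = tensor scale scale 1 1"
    and counit_mult: "counit (x * y) = counit x * counit y"
    and counit_one: "counit 1 = 1"

locale hopf_algebra = bialgebra scale comult counit
  for scale :: "'f::field \<Rightarrow> 'a::{ring, monoid_mult} \<Rightarrow> 'a" and comult counit +
  fixes antipode :: "'a \<Rightarrow> 'a"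
  assumes antipode_linear: "Vector_Spaces.linear scale scale antipode"
    and antipode_left: "sweedler scale (\<lambda>x1 x2. antipode x1 * x2) (comult x) = scale (counit x) 1"
    and antipode_right: "sweedler scale (\<lambda>x1 x2. x1 * antipode x2) (comult x) = scale (counit x) 1"

text \<open>
  A homomorphism of Hopf algebras is an algebra and coalgebra map; compatibility with the
  antipodes is then automatic.
\<close>

definition hopf_algebra_hom ::
  "('f::field \<Rightarrow> 'a::{ring, monoid_mult} \<Rightarrow> 'a) \<Rightarrow> ('a \<Rightarrow> ('f, 'a, 'a) tensor) \<Rightarrow> ('a \<Rightarrow> 'f)
    \<Rightarrow> ('f \<Rightarrow> 'b::{ring, monoid_mult} \<Rightarrow> 'b) \<Rightarrow> ('b \<Rightarrow> ('f, 'b, 'b) tensor) \<Rightarrow> ('b \<Rightarrow> 'f)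
    \<Rightarrow> ('a \<Rightarrow> 'b) \<Rightarrow> bool" where
  "hopf_algebra_hom sA \<Delta>A \<epsilon>A sB \<Delta>B \<epsilon>B f \<longleftrightarrow>
      Vector_Spaces.linear sA sB f
    \<and> (\<forall>x y. f (x * y) = f x * f y) \<and> f 1 = 1
    \<and> (\<forall>x. \<Delta>B (f x) = tensor_map sB sB f f (\<Delta>A x)) \<and> (\<forall>x. \<epsilon>B (f x) = \<epsilon>A x)"


section \<open>Modules and comodules\<close>

definition left_module ::
  "('f::field \<Rightarrow> 'a::{ring, monoid_mult} \<Rightarrow> 'a) \<Rightarrow> ('f \<Rightarrow> 'm::ab_group_add \<Rightarrow> 'm)
    \<Rightarrow> ('a \<Rightarrow> 'm \<Rightarrow> 'm) \<Rightarrow> bool" where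
  "left_module sA sM act \<longleftrightarrow> bilinear_map sA sM sM act
    \<and> (\<forall>m. act 1 m = m) \<and> (\<forall>a b m. act (a * b) m = act a (act b m))"

definition right_module ::
  "('f::field \<Rightarrow> 'a::{ring, monoid_mult} \<Rightarrow> 'a) \<Rightarrow> ('f \<Rightarrow> 'm::ab_group_add \<Rightarrow> 'm)
    \<Rightarrow> ('m \<Rightarrow> 'a \<Rightarrow> 'm) \<Rightarrow> bool" where
  "right_module sA sM act \<longleftrightarrow> bilinear_map sM sA sM act
    \<and> (\<forall>m. act m 1 = m) \<and> (\<forall>m a b. act m (a * b) = act (act m a) b)"

text \<open>
  \<open>act\<close> is viewed as a linear map on the tensor product of \<open>C\<close> and \<open>D\<close>, which carries the tensor
  product coalgebra structure.
\<close>

definition coalgebra_action ::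
  "('c::ab_group_add \<Rightarrow> ('f::field, 'c, 'c) tensor) \<Rightarrow> ('c \<Rightarrow> 'f)
    \<Rightarrow> ('d::ab_group_add \<Rightarrow> ('f, 'd, 'd) tensor) \<Rightarrow> ('d \<Rightarrow> 'f)
    \<Rightarrow> ('f \<Rightarrow> 'e::ab_group_add \<Rightarrow> 'e) \<Rightarrow> ('e \<Rightarrow> ('f, 'e, 'e) tensor) \<Rightarrow> ('e \<Rightarrow> 'f)
    \<Rightarrow> ('c \<Rightarrow> 'd \<Rightarrow> 'e) \<Rightarrow> bool" where
  "coalgebra_action \<Delta>C \<epsilon>C \<Delta>D \<epsilon>D sE \<Delta>E \<epsilon>E act \<longleftrightarrow>
    (\<forall>x y. \<Delta>E (act x y) =
      sweedler_tensor sE sE (\<lambda>x1 x2. sweedler_tensor sE sE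
        (\<lambda>y1 y2. tensor sE sE (act x1 y1) (act x2 y2)) (\<Delta>D y)) (\<Delta>C x))
    \<and> (\<forall>x y. \<epsilon>E (act x y) = \<epsilon>C x * \<epsilon>D y)"

locale left_module_coalgebra =
  B: hopf_algebra sB \<Delta>B \<epsilon>B SB + C: coalgebra sC \<Delta>C \<epsilon>C
  for sB :: "'f::field \<Rightarrow> 'b::{ring, monoid_mult} \<Rightarrow> 'b" and \<Delta>B \<epsilon>B SB
    and sC :: "'f \<Rightarrow> 'c::ab_group_add \<Rightarrow> 'c" and \<Delta>C \<epsilon>C +
  fixes act :: "'b \<Rightarrow> 'c \<Rightarrow> 'c"
  assumes act_module: "left_module sB sC act"
    and act_coalgebra: "coalgebra_action \<Delta>B \<epsilon>B \<Delta>C \<epsilon>C sC \<Delta>C \<epsilon>C act"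

locale right_module_coalgebra =
  B: hopf_algebra sB \<Delta>B \<epsilon>B SB + C: coalgebra sC \<Delta>C \<epsilon>C
  for sB :: "'f::field \<Rightarrow> 'b::{ring, monoid_mult} \<Rightarrow> 'b" and \<Delta>B \<epsilon>B SB
    and sC :: "'f \<Rightarrow> 'c::ab_group_add \<Rightarrow> 'c" and \<Delta>C \<epsilon>C +
  fixes act :: "'c \<Rightarrow> 'b \<Rightarrow> 'c"
  assumes act_module: "right_module sB sC act"
    and act_coalgebra: "coalgebra_action \<Delta>C \<epsilon>C \<Delta>B \<epsilon>B sC \<Delta>C \<epsilon>C act"

locale left_comodule =
  C: coalgebra sC \<Delta>C \<epsilon>C + M: vector_space sM
  for sC :: "'f::field \<Rightarrow> 'c::ab_group_add \<Rightarrow> 'c" and \<Delta>C \<epsilon>C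
    and sM :: "'f \<Rightarrow> 'm::ab_group_add \<Rightarrow> 'm" +
  fixes coact :: "'m \<Rightarrow> ('f, 'c, 'm) tensor"
  assumes coact_linear: "linear_to_tensor sM sC sM coact"
    and coact_coassoc:
      "sweedler_tensor3 sC sC sM
          (\<lambda>c m0. sweedler_tensor3 sC sC sM (\<lambda>c1 c2. tensor3 sC sC sM c1 c2 m0) (\<Delta>C c)) (coact m)
        = sweedler_tensor3 sC sC sM
          (\<lambda>c m0. sweedler_tensor3 sC sC sM (\<lambda>d m00. tensor3 sC sC sM c d m00) (coact m0)) (coact m)"
    and coact_counit: "sweedler sM (\<lambda>c m0. sM (\<epsilon>C c) m0) (coact m) = m"

locale left_comodule_algebra =
  B: hopf_algebra sB \<Delta>B \<epsilon>B SB + A: unital_algebra sA + left_comodule sB \<Delta>B \<epsilon>B sA coact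
  for sB :: "'f::field \<Rightarrow> 'b::{ring, monoid_mult} \<Rightarrow> 'b" and \<Delta>B \<epsilon>B SB
    and sA :: "'f \<Rightarrow> 'a::{ring, monoid_mult} \<Rightarrow> 'a" and coact +
  assumes coact_mult:
      "coact (x * y) =
        sweedler_tensor sB sA (\<lambda>b x0. sweedler_tensor sB sA
          (\<lambda>c y0. tensor sB sA (b * c) (x0 * y0)) (coact y)) (coact x)"
    and coact_one: "coact 1 = tensor sB sA 1 1"


section \<open>Doi-Hopf modules\<close>

text \<open>
  The parameters describe, in this order, the Hopf algebra \<open>B\<close>, the left \<open>B\<close>-comodule algebra
  \<open>A\<close>, the right \<open>B\<close>-module coalgebra \<open>C\<close>, and the \<open>(B, A, C)\<close>-Doi-Hopf module \<open>M\<close>.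
\<close>

locale doi_hopf_module =
  A: left_comodule_algebra sB \<Delta>B \<epsilon>B SB sA coactA +
  C: right_module_coalgebra sB \<Delta>B \<epsilon>B SB sC \<Delta>C \<epsilon>C actC +
  M: left_comodule sC \<Delta>C \<epsilon>C sM coactM
  for sB :: "'f::field \<Rightarrow> 'b::{ring, monoid_mult} \<Rightarrow> 'b" and \<Delta>B \<epsilon>B SB
    and sA :: "'f \<Rightarrow> 'a::{ring, monoid_mult} \<Rightarrow> 'a" and coactA
    and sC :: "'f \<Rightarrow> 'c::ab_group_add \<Rightarrow> 'c" and \<Delta>C \<epsilon>C actC
    and sM :: "'f \<Rightarrow> 'm::ab_group_add \<Rightarrow> 'm" and actM :: "'m \<Rightarrow> 'a \<Rightarrow> 'm" and coactM +
  assumes actM_module: "right_module sA sM actM"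
    and coactM_actM:
      "coactM (actM m a) =
        sweedler_tensor sC sM (\<lambda>c m0. sweedler_tensor sC sM
          (\<lambda>b a0. tensor sC sM (actC c b) (actM m0 a0)) (coactA a)) (coactM m)"

locale doi_hopf_module_morphism =
  M: doi_hopf_module sB \<Delta>B \<epsilon>B SB sA coactA sC \<Delta>C \<epsilon>C actC sM actM coactM +
  N: doi_hopf_module sB \<Delta>B \<epsilon>B SB sA coactA sC \<Delta>C \<epsilon>C actC sN actN coactN
  for sB :: "'f::field \<Rightarrow> 'b::{ring, monoid_mult} \<Rightarrow> 'b" and \<Delta>B \<epsilon>B SB
    and sA :: "'f \<Rightarrow> 'a::{ring, monoid_mult} \<Rightarrow> 'a" and coactA
    and sC :: "'f \<Rightarrow> 'c::ab_group_add \<Rightarrow> 'c" and \<Delta>C \<epsilon>C actC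
    and sM :: "'f \<Rightarrow> 'm::ab_group_add \<Rightarrow> 'm" and actM :: "'m \<Rightarrow> 'a \<Rightarrow> 'm" and coactM
    and sN :: "'f \<Rightarrow> 'n::ab_group_add \<Rightarrow> 'n" and actN :: "'n \<Rightarrow> 'a \<Rightarrow> 'n" and coactN +
  fixes f :: "'m \<Rightarrow> 'n"
  assumes f_linear: "Vector_Spaces.linear sM sN f"
    and f_act: "f (actM m a) = actN (f m) a"
    and f_coact: "coactN (f m) = tensor_map sC sN id f (coactM m)"


section \<open>Matched pairs of Hopf algebras\<close>

locale matched_pair =
  L: left_module_coalgebra sH \<Delta>H \<epsilon>H SH sK \<Delta>K \<epsilon>K lact +
  R: right_module_coalgebra sK \<Delta>K \<epsilon>K SK sH \<Delta>H \<epsilon>H ract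
  for sH :: "'f::field \<Rightarrow> 'h::{ring, monoid_mult} \<Rightarrow> 'h" and \<Delta>H \<epsilon>H SH
    and sK :: "'f \<Rightarrow> 'k::{ring, monoid_mult} \<Rightarrow> 'k" and \<Delta>K \<epsilon>K SK
    and lact :: "'h \<Rightarrow> 'k \<Rightarrow> 'k" (infixr "\<rightharpoonup>" 75)
    and ract :: "'h \<Rightarrow> 'k \<Rightarrow> 'h" (infixl "\<leftharpoonup>" 75) +
  assumes lact_mult:
      "x \<rightharpoonup> (a * b) =
        sweedler sK (\<lambda>x1 x2. sweedler sK
          (\<lambda>a1 a2. (x1 \<rightharpoonup> a1) * ((x2 \<leftharpoonup> a2) \<rightharpoonup> b)) (\<Delta>K a)) (\<Delta>H x)"
    and lact_one: "x \<rightharpoonup> 1 = sK (\<epsilon>H x) 1"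
    and mult_ract:
      "(x * y) \<leftharpoonup> a =
        sweedler sH (\<lambda>y1 y2. sweedler sH
          (\<lambda>a1 a2. (x \<leftharpoonup> (y1 \<rightharpoonup> a1)) * (y2 \<leftharpoonup> a2)) (\<Delta>K a)) (\<Delta>H y)"
    and one_ract: "1 \<leftharpoonup> a = sH (\<epsilon>K a) 1"
    and lact_ract_swap:
      "sweedler_tensor sK sH (\<lambda>x1 x2. sweedler_tensor sK sH
          (\<lambda>a1 a2. tensor sK sH (x1 \<rightharpoonup> a1) (x2 \<leftharpoonup> a2)) (\<Delta>K a)) (\<Delta>H x)
        = sweedler_tensor sK sH (\<lambda>x1 x2. sweedler_tensor sK sH
          (\<lambda>a1 a2. tensor sK sH (x2 \<rightharpoonup> a2) (x1 \<leftharpoonup> a1)) (\<Delta>K a)) (\<Delta>H x)"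


section \<open>The Doi-Hopf module structure induced by a homomorphism\<close>

definition ract_hom ::
  "('f::field \<Rightarrow> 'k::{ring, monoid_mult} \<Rightarrow> 'k) \<Rightarrow> ('k \<Rightarrow> ('f, 'k, 'k) tensor) \<Rightarrow> ('k \<Rightarrow> 'k)
    \<Rightarrow> ('h \<Rightarrow> 'k \<Rightarrow> 'k) \<Rightarrow> ('k \<Rightarrow> 'h) \<Rightarrow> 'k \<Rightarrow> 'k \<Rightarrow> 'k" where
  "ract_hom sK \<Delta>K SK lact \<pi> a b =
    sweedler sK (\<lambda>a1 a2. sweedler sK
      (\<lambda>b1 b2. SK (lact (\<pi> a1) b1) * a2 * b2) (\<Delta>K b)) (\<Delta>K a)"

definition coact_hom ::
  "('f::field \<Rightarrow> 'h::ab_group_add \<Rightarrow> 'h) \<Rightarrow> ('f \<Rightarrow> 'k::ab_group_add \<Rightarrow> 'k)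
    \<Rightarrow> ('k \<Rightarrow> ('f, 'k, 'k) tensor) \<Rightarrow> ('k \<Rightarrow> 'h) \<Rightarrow> 'k \<Rightarrow> ('f, 'h, 'k) tensor" where
  "coact_hom sH sK \<Delta>K \<pi> a = tensor_map sH sK \<pi> id (\<Delta>K a)"

end

theory Submission
  imports Defs
begin

text \<open>
  Write \<open>F a b = \<pi> a \<rightharpoonup> b\<close>, a coalgebra map on \<open>K \<otimes> K\<close>, and \<open>G a b\<close> for the action of \<open>b\<close> on \<open>a\<close> induced
  by \<open>\<pi>\<close>. The map \<open>F\<close> has the two-sided convolution inverse \<open>S\<^sub>K \<circ> F\<close>, so \<open>G\<close> is the unique map whose
  convolution product \<open>F * G\<close> is the multiplication of \<open>K\<close>. Each of the nontrivial identities (\<open>\<pi>\<close> is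
  linear for the actions, compatibility of \<open>G\<close> with the coaction, associativity of \<open>G\<close>) follows by
  multiplying both sides by a convolution invertible map built from \<open>F\<close> and comparing, which
  needs neither anti-multiplicativity nor anti-comultiplicativity of the antipode.

  Equations between tensors are tested against all bilinear (or trilinear) functionals, which
  separate points because the ground ring is a field.
\<close>

section \<open>Linear and multilinear maps\<close>

lemma vector_space_field: "vector_space ((*) :: 'f::field \<Rightarrow> 'f \<Rightarrow> 'f)"
  by unfold_locales (simp_all add: algebra_simps)

lemma linearD:
  assumes "Vector_Spaces.linear sA sB f"
  shows "vector_space sA" "vector_space sB" "f (x + y) = f x + f y" "f (sA c x) = sB c (f x)" "f 0 = 0"
    "f (sum g I) = (\<Sum>i\<in>I. f (g i))"
proof -
  interpret Vector_Spaces.linear sA sB f by fact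
  show "vector_space sA" "vector_space sB" "f (x + y) = f x + f y" "f (sA c x) = sB c (f x)" "f 0 = 0"
    "f (sum g I) = (\<Sum>i\<in>I. f (g i))"
    by (unfold_locales) (auto simp: add scale zero sum)
qed

lemma linear_comp:
  assumes "Vector_Spaces.linear sB sC g" "Vector_Spaces.linear sA sB f"
  shows "Vector_Spaces.linear sA sC (\<lambda>x. g (f x))"
  using assms by (simp add: Vector_Spaces.linear_iff)

lemma linear_sum:
  assumes "vector_space sA" "vector_space sB" "\<And>i. i \<in> I \<Longrightarrow> Vector_Spaces.linear sA sB (f i)"
  shows "Vector_Spaces.linear sA sB (\<lambda>x. \<Sum>i\<in>I. f i x)"
proof -
  interpret A: vector_space sA by fact
  interpret B: vector_space sB by fact
  show ?thesis
    using assms(3) by (auto simp: Vector_Spaces.linear_iff A.vector_space_axioms B.vector_space_axioms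
      sum.distrib B.scale_sum_right intro!: sum.cong)
qed

lemma linear_scale_right:
  assumes "Vector_Spaces.linear sA sB f"
  shows "Vector_Spaces.linear sA sB (\<lambda>x. sB c (f x))"
proof -
  interpret Vector_Spaces.linear sA sB f by fact
  show ?thesis
    by (auto simp: Vector_Spaces.linear_iff vs1.vector_space_axioms vs2.vector_space_axioms add scale
      vs2.scale_right_distrib vs2.scale_left_commute)
qed

lemma linear_scale_left:
  assumes "Vector_Spaces.linear sA (*) f" "vector_space sB"
  shows "Vector_Spaces.linear sA sB (\<lambda>x. sB (f x) v)"
proof -
  interpret Vector_Spaces.linear sA "(*)" f by fact
  interpret B: vector_space sB by fact
  show ?thesis
    by (auto simp: Vector_Spaces.linear_iff vs1.vector_space_axioms B.vector_space_axioms add scale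
      B.scale_left_distrib)
qed

lemma linear_ident: "vector_space sA \<Longrightarrow> Vector_Spaces.linear sA sA (\<lambda>x. x)"
  by (simp add: Vector_Spaces.linear_iff)

lemma bilinear_mapI:
  assumes "\<And>a. Vector_Spaces.linear sB sC (f a)" "\<And>b. Vector_Spaces.linear sA sC (\<lambda>a. f a b)"
  shows "bilinear_map sA sB sC f"
  using assms by (simp add: bilinear_map_def)

lemma bilinear_mapD:
  assumes "bilinear_map sA sB sC f"
  shows "Vector_Spaces.linear sB sC (f a)" "Vector_Spaces.linear sA sC (\<lambda>a. f a b)" "vector_space sC"
  using assms linearD(2) unfolding bilinear_map_def by blast+

definition trilinear_map ::
  "('f::field \<Rightarrow> 'a::ab_group_add \<Rightarrow> 'a) \<Rightarrow> ('f \<Rightarrow> 'b::ab_group_add \<Rightarrow> 'b) \<Rightarrow> ('f \<Rightarrow> 'c::ab_group_add \<Rightarrow> 'c)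
    \<Rightarrow> ('f \<Rightarrow> 'd::ab_group_add \<Rightarrow> 'd) \<Rightarrow> ('a \<Rightarrow> 'b \<Rightarrow> 'c \<Rightarrow> 'd) \<Rightarrow> bool" where
  "trilinear_map sA sB sC sD f \<longleftrightarrow>
    (\<forall>b c. Vector_Spaces.linear sA sD (\<lambda>a. f a b c)) \<and> (\<forall>a c. Vector_Spaces.linear sB sD (\<lambda>b. f a b c))
    \<and> (\<forall>a b. Vector_Spaces.linear sC sD (\<lambda>c. f a b c))"

lemma trilinear_mapI:
  assumes "\<And>b c. Vector_Spaces.linear sA sD (\<lambda>a. f a b c)" "\<And>a c. Vector_Spaces.linear sB sD (\<lambda>b. f a b c)"
    "\<And>a b. Vector_Spaces.linear sC sD (\<lambda>c. f a b c)"
  shows "trilinear_map sA sB sC sD f"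
  using assms by (simp add: trilinear_map_def)

lemma trilinear_mapD:
  assumes "trilinear_map sA sB sC sD f"
  shows "Vector_Spaces.linear sA sD (\<lambda>a. f a b c)" "Vector_Spaces.linear sB sD (\<lambda>b. f a b c)"
    "Vector_Spaces.linear sC sD (\<lambda>c. f a b c)" "vector_space sD"
  using assms linearD(2) unfolding trilinear_map_def by blast+

section \<open>Free vector spaces\<close>

lemma lookup_free_scale: "Poly_Mapping.lookup (free_scale c u) x = c * Poly_Mapping.lookup u x"
  unfolding free_scale_def by (simp add: Poly_Mapping.map.rep_eq when_def)

interpretation free: vector_space free_scale
  by unfold_locales (auto intro!: poly_mapping_eqI simp: lookup_free_scale lookup_add algebra_simps)

text \<open>Coefficients vanish off the support, so the sum may run over any finite set containing
  it. Combinations with different supports thereby get a common index set.\<close>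

lemma free_extend_eq_sum:
  assumes "vector_space s" "finite I" "Poly_Mapping.keys u \<subseteq> I"
  shows "free_extend s f u = (\<Sum>x\<in>I. s (Poly_Mapping.lookup u x) (f x))"
proof -
  interpret vector_space s by fact
  show ?thesis
    unfolding free_extend_def
    by (rule sum.mono_neutral_left) (use assms in \<open>auto simp: in_keys_iff\<close>)
qed

lemma linear_free_extend:
  fixes s :: "'f::field \<Rightarrow> 'v::ab_group_add \<Rightarrow> 'v" and f :: "'x \<Rightarrow> 'v"
  assumes "vector_space s"
  shows "Vector_Spaces.linear free_scale s (free_extend s f)"
proof -
  interpret vector_space s by fact
  have "free_extend s f (u + v) = free_extend s f u + free_extend s f v" for u v :: "'x \<Rightarrow>\<^sub>0 'f"
  proof -
    let ?I = "Poly_Mapping.keys u \<union> Poly_Mapping.keys v"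
    have "Poly_Mapping.keys (u + v) \<subseteq> ?I" by (rule keys_add)
    then show ?thesis
      by (simp add: free_extend_eq_sum[OF assms, of ?I] lookup_add scale_left_distrib sum.distrib)
  qed
  moreover have "free_extend s f (free_scale c u) = s c (free_extend s f u)" for c and u :: "'x \<Rightarrow>\<^sub>0 'f"
  proof -
    have "Poly_Mapping.keys (free_scale c u) \<subseteq> Poly_Mapping.keys u"
      by (auto simp: in_keys_iff lookup_free_scale)
    then show ?thesis
      by (simp add: free_extend_eq_sum[OF assms, of "Poly_Mapping.keys u"] lookup_free_scale
          scale_sum_right)
  qed
  ultimately show ?thesis
    by (simp add: Vector_Spaces.linear_iff free.vector_space_axioms assms)
qed

lemma free_extend_gen:
  assumes "vector_space s"
  shows "free_extend s f (free_gen x) = f x"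
proof -
  interpret vector_space s by fact
  show ?thesis by (simp add: free_extend_def free_gen_def)
qed

lemma linear_free_extend_comp:
  assumes "Vector_Spaces.linear sV sW L"
  shows "L (free_extend sV f u) = free_extend sW (\<lambda>x. L (f x)) u"
  by (simp add: free_extend_def linearD[OF assms])

text \<open>Uniqueness in the universal property: \<open>u\<close> is the combination of the
  generators with its own coefficients, and \<open>L\<close> passes through that sum.\<close>

lemma linear_eq_free_extend:
  assumes "Vector_Spaces.linear free_scale s L"
  shows "L u = free_extend s (\<lambda>x. L (free_gen x)) u"
proof -
  have "u = free_extend free_scale free_gen u"
  proof (rule poly_mapping_eqI)
    fix k
    have "Poly_Mapping.lookup (free_extend free_scale free_gen u) k
      = (\<Sum>x\<in>Poly_Mapping.keys u. Poly_Mapping.lookup u x * (1 when x = k))"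
      by (simp add: free_extend_def lookup_sum lookup_free_scale free_gen_def lookup_single)
    also have "\<dots> = (\<Sum>x\<in>Poly_Mapping.keys u. if x = k then Poly_Mapping.lookup u x else 0)"
      by (rule sum.cong) (auto simp: when_def)
    also have "\<dots> = Poly_Mapping.lookup u k"
      by (simp add: in_keys_iff)
    finally show "Poly_Mapping.lookup u k = Poly_Mapping.lookup (free_extend free_scale free_gen u) k" ..
  qed
  then show ?thesis using linear_free_extend_comp[OF assms] by metis
qed

lemma linear_vanish_span:
  assumes "Vector_Spaces.linear sA sB f" "\<And>r. r \<in> R \<Longrightarrow> f r = 0" "u \<in> module.span sA R"
  shows "f u = 0"
proof -
  interpret Vector_Spaces.linear sA sB f by fact
  show ?thesis using assms(2,3) by (rule eq_0_on_span)
qed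

text \<open>A maximal independent subset \<open>B\<close> of \<open>R\<close> still spans
  \<open>R\<close>, and adding \<open>w\<close> keeps it independent. A functional can then be
  prescribed as 1 at \<open>w\<close> and 0 on \<open>B\<close>; this is where the scalars being a
  field enters.\<close>

lemma separating_functional:
  assumes "vector_space sV" "w \<notin> module.span sV R"
  obtains L where "Vector_Spaces.linear sV (*) L" "\<And>r. r \<in> module.span sV R \<Longrightarrow> L r = 0" "L w \<noteq> 0"
proof -
  interpret V: vector_space sV by fact
  interpret P: vector_space_pair sV "(*) :: 'a \<Rightarrow> 'a \<Rightarrow> 'a"
    by (simp add: vector_space_pair_def assms(1) vector_space_field)
  obtain B where B: "B \<subseteq> R" "V.independent B" "R \<subseteq> V.span B"
    using V.maximal_independent_subset by blast
  have sp: "V.span R \<subseteq> V.span B" using V.span_minimal[OF B(3)] by auto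
  have "w \<notin> V.span B" using assms(2) V.span_mono[OF B(1)] by auto
  then have ind: "V.independent (insert w B)" using B(2) by (rule V.independent_insertI)
  then obtain L where L: "Vector_Spaces.linear sV (*) L"
    "\<And>x. x \<in> insert w B \<Longrightarrow> L x = (if x = w then 1 else 0)"
    using P.linear_independent_extend[OF ind, of "\<lambda>x. if x = w then 1 else 0"] by blast
  have "w \<notin> B" using \<open>w \<notin> V.span B\<close> V.span_base by blast
  then have "L r = 0" if "r \<in> V.span R" for r
    using linear_vanish_span[OF L(1), of B r] L(2) that sp by fastforce
  then show ?thesis using L that by auto
qed

section \<open>Tensors and their Sweedler sums\<close>

lemma tensor_relatorI:
  "free_gen (a + a', b) - free_gen (a, b) - free_gen (a', b) \<in> tensor_relators sA sB"
  "free_gen (a, b + b') - free_gen (a, b) - free_gen (a, b') \<in> tensor_relators sA sB"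
  "free_gen (sA r a, b) - free_scale r (free_gen (a, b)) \<in> tensor_relators sA sB"
  "free_gen (a, sB r b) - free_scale r (free_gen (a, b)) \<in> tensor_relators sA sB"
  unfolding tensor_relators_def
  apply (rule UnI1, rule UnI1, rule UnI1, blast)
  apply (rule UnI1, rule UnI1, rule UnI2, blast)
  apply (rule UnI1, rule UnI2, blast)
  apply (rule UnI2, blast)
  done

lemma tensor3_relatorI:
  "free_gen (a + a', b, c) - free_gen (a, b, c) - free_gen (a', b, c) \<in> tensor3_relators sA sB sC"
  "free_gen (a, b + b', c) - free_gen (a, b, c) - free_gen (a, b', c) \<in> tensor3_relators sA sB sC"
  "free_gen (a, b, c + c') - free_gen (a, b, c) - free_gen (a, b, c') \<in> tensor3_relators sA sB sC"
  "free_gen (sA r a, b, c) - free_scale r (free_gen (a, b, c)) \<in> tensor3_relators sA sB sC"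
  "free_gen (a, sB r b, c) - free_scale r (free_gen (a, b, c)) \<in> tensor3_relators sA sB sC"
  "free_gen (a, b, sC r c) - free_scale r (free_gen (a, b, c)) \<in> tensor3_relators sA sB sC"
  unfolding tensor3_relators_def
  apply (rule UnI1, rule UnI1, rule UnI1, rule UnI1, rule UnI1, blast)
  apply (rule UnI1, rule UnI1, rule UnI1, rule UnI1, rule UnI2, blast)
  apply (rule UnI1, rule UnI1, rule UnI1, rule UnI2, blast)
  apply (rule UnI1, rule UnI1, rule UnI2, blast)
  apply (rule UnI1, rule UnI2, blast)
  apply (rule UnI2, blast)
  done

lemma mem_tensor_class_self: "u \<in> tensor_class sA sB u" "u' \<in> tensor3_class sA sB sC u'"
  by (simp_all add: tensor_class_def tensor3_class_def free.span_zero)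

text \<open>A coset contains the combination it is formed from, so it is nonempty and the choice in
  \<open>tensor_rep\<close> picks one of its members.\<close>

lemma tensor_rep_class:
  "tensor_rep (tensor_class sA sB u) \<in> tensor_class sA sB u"
  "tensor_rep (tensor3_class sA sB sC u') \<in> tensor3_class sA sB sC u'"
  unfolding tensor_rep_def
  using someI[of "\<lambda>v. v \<in> tensor_class sA sB u", OF mem_tensor_class_self(1)]
    someI[of "\<lambda>v. v \<in> tensor3_class sA sB sC u'", OF mem_tensor_class_self(2)] by simp_all

lemma tensor_class_eqI:
  assumes "v - u \<in> module.span free_scale (tensor_relators sA sB)"
  shows "tensor_class sA sB v = tensor_class sA sB u"
proof -
  have "w - v \<in> free.span (tensor_relators sA sB) \<longleftrightarrow> w - u \<in> free.span (tensor_relators sA sB)" for w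
    using free.span_add_eq[OF assms, of "w - v"] by (simp add: algebra_simps)
  then show ?thesis by (simp add: tensor_class_def)
qed

lemma tensor3_class_eqI:
  assumes "v - u \<in> module.span free_scale (tensor3_relators sA sB sC)"
  shows "tensor3_class sA sB sC v = tensor3_class sA sB sC u"
proof -
  have "w - v \<in> free.span (tensor3_relators sA sB sC) \<longleftrightarrow> w - u \<in> free.span (tensor3_relators sA sB sC)" for w
    using free.span_add_eq[OF assms, of "w - v"] by (simp add: algebra_simps)
  then show ?thesis by (simp add: tensor3_class_def)
qed

section \<open>Maps on tensor products induced by multilinear maps\<close>

text \<open>Each relator expresses one instance of bilinearity, so the free extension of
  \<open>f\<close> kills it, and then also the span. This is the well-definedness of the induced map
  on the quotient.\<close>

lemma free_extend_tensor_relators: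
  assumes "bilinear_map sA sB sV f" "u \<in> module.span free_scale (tensor_relators sA sB)"
  shows "free_extend sV (\<lambda>(a, b). f a b) u = 0"
proof (rule linear_vanish_span[OF _ _ assms(2)])
  have V: "vector_space sV" using assms(1) by (rule bilinear_mapD)
  show lin: "Vector_Spaces.linear free_scale sV (free_extend sV (\<lambda>(a, b). f a b))"
    using V by (rule linear_free_extend)
  interpret E: Vector_Spaces.linear free_scale sV "free_extend sV (\<lambda>(a, b). f a b)" by (rule lin)
  show "free_extend sV (\<lambda>(a, b). f a b) r = 0" if "r \<in> tensor_relators sA sB" for r
    using that linearD(3,4)[OF bilinear_mapD(1)[OF assms(1)]] linearD(3,4)[OF bilinear_mapD(2)[OF assms(1)]]
    unfolding tensor_relators_def by (auto simp: E.diff E.scale free_extend_gen[OF V])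
qed

lemma free_extend_tensor3_relators:
  assumes "trilinear_map sA sB sC sV f" "u \<in> module.span free_scale (tensor3_relators sA sB sC)"
  shows "free_extend sV (\<lambda>(a, b, c). f a b c) u = 0"
proof (rule linear_vanish_span[OF _ _ assms(2)])
  have V: "vector_space sV" using assms(1) by (rule trilinear_mapD)
  show lin: "Vector_Spaces.linear free_scale sV (free_extend sV (\<lambda>(a, b, c). f a b c))"
    using V by (rule linear_free_extend)
  interpret E: Vector_Spaces.linear free_scale sV "free_extend sV (\<lambda>(a, b, c). f a b c)" by (rule lin)
  show "free_extend sV (\<lambda>(a, b, c). f a b c) r = 0" if "r \<in> tensor3_relators sA sB sC" for r
    using that linearD(3,4)[OF trilinear_mapD(1)[OF assms(1)]] linearD(3,4)[OF trilinear_mapD(2)[OF assms(1)]]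
      linearD(3,4)[OF trilinear_mapD(3)[OF assms(1)]]
    unfolding tensor3_relators_def by (auto simp: E.diff E.scale free_extend_gen[OF V])
qed

text \<open>The chosen representative differs from \<open>u\<close> by an element of the span of the
  relators, which contributes nothing. Any representative may therefore be used for the
  evaluation.\<close>

lemma sweedler_class:
  assumes "bilinear_map sA sB sV f"
  shows "sweedler sV f (tensor_class sA sB u) = free_extend sV (\<lambda>(a, b). f a b) u"
proof -
  have V: "vector_space sV" using assms by (rule bilinear_mapD)
  interpret E: Vector_Spaces.linear free_scale sV "free_extend sV (\<lambda>(a, b). f a b)"
    using V by (rule linear_free_extend)
  have "tensor_rep (tensor_class sA sB u) - u \<in> free.span (tensor_relators sA sB)"
    using tensor_rep_class(1)[of sA sB u] by (simp add: tensor_class_def)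
  from free_extend_tensor_relators[OF assms this] show ?thesis
    by (simp add: sweedler_def E.diff)
qed

text \<open>The threefold counterpart of \<open>sweedler\<close>. It turns coassociativity, an
  equation in a threefold tensor product, into equations between vectors.\<close>

definition sweedler3 ::
  "('f::field \<Rightarrow> 'v::ab_group_add \<Rightarrow> 'v) \<Rightarrow> ('a \<Rightarrow> 'b \<Rightarrow> 'c \<Rightarrow> 'v) \<Rightarrow> ('f, 'a, 'b, 'c) tensor3 \<Rightarrow> 'v" where
  "sweedler3 sV f t = free_extend sV (\<lambda>(a, b, c). f a b c) (tensor_rep t)"

lemma sweedler3_class:
  assumes "trilinear_map sA sB sC sV f"
  shows "sweedler3 sV f (tensor3_class sA sB sC u) = free_extend sV (\<lambda>(a, b, c). f a b c) u"
proof -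
  have V: "vector_space sV" using assms by (rule trilinear_mapD)
  interpret E: Vector_Spaces.linear free_scale sV "free_extend sV (\<lambda>(a, b, c). f a b c)"
    using V by (rule linear_free_extend)
  have "tensor_rep (tensor3_class sA sB sC u) - u \<in> free.span (tensor3_relators sA sB sC)"
    using tensor_rep_class(2)[of sA sB sC u] by (simp add: tensor3_class_def)
  from free_extend_tensor3_relators[OF assms this] show ?thesis
    by (simp add: sweedler3_def E.diff)
qed

lemma sweedler_tensor:
  assumes "bilinear_map sA sB sV f"
  shows "sweedler sV f (tensor sA sB a b) = f a b"
  using assms by (simp add: tensor_def sweedler_class free_extend_gen[OF bilinear_mapD(3)])

lemma sweedler3_tensor3:
  assumes "trilinear_map sA sB sC sV f"
  shows "sweedler3 sV f (tensor3 sA sB sC a b c) = f a b c"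
  using assms by (simp add: tensor3_def sweedler3_class free_extend_gen[OF trilinear_mapD(4)])

text \<open>The linear map induced by \<open>f\<close> commutes with the combination formed by
  \<open>sweedler_tensor\<close>, so it moves inside the sum. Tensor-valued axioms become
  vector-valued identities in this way.\<close>

lemma sweedler_sweedler_tensor:
  assumes "bilinear_map sA sB sV f"
  shows "sweedler sV f (sweedler_tensor sA sB g t) = sweedler sV (\<lambda>a b. sweedler sV f (g a b)) t"
  unfolding sweedler_tensor_def sweedler_class[OF assms]
  by (simp add: sweedler_def
      linear_free_extend_comp[OF linear_free_extend[OF bilinear_mapD(3)[OF assms]]] case_prod_unfold)

lemma sweedler3_sweedler_tensor3:
  assumes "trilinear_map sA sB sC sV f"
  shows "sweedler3 sV f (sweedler_tensor3 sA sB sC g t) = sweedler sV (\<lambda>a b. sweedler3 sV f (g a b)) t"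
  unfolding sweedler_tensor3_def sweedler3_class[OF assms]
  by (simp add: sweedler3_def sweedler_def
      linear_free_extend_comp[OF linear_free_extend[OF trilinear_mapD(4)[OF assms]]] case_prod_unfold)

lemma sweedler_tensor_map:
  assumes "bilinear_map sC sD sV f"
  shows "sweedler sV f (tensor_map sC sD g h t) = sweedler sV (\<lambda>a b. f (g a) (h b)) t"
  by (simp add: tensor_map_def sweedler_sweedler_tensor[OF assms] sweedler_tensor[OF assms])

lemma tensor_in_range [simp]:
  "tensor sA sB a b \<in> range (tensor_class sA sB)"
  "sweedler_tensor sA sB g t \<in> range (tensor_class sA sB)"
  "tensor_map sA sB h k t \<in> range (tensor_class sA sB)"
  "sweedler_tensor3 sA sB sC g' t \<in> range (tensor3_class sA sB sC)"
  by (simp_all add: tensor_def sweedler_tensor_def tensor_map_def sweedler_tensor3_def)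

section \<open>Separation of tensors by multilinear functionals\<close>

text \<open>If the difference of two representatives were outside the span of the relators, some
  functional would vanish on the span but not on the difference. Vanishing on the relators makes its
  values on generators a bilinear map, which then distinguishes \<open>t\<close> from
  \<open>t'\<close>.\<close>

lemma tensor_eqI:
  fixes sA :: "'f::field \<Rightarrow> 'a::ab_group_add \<Rightarrow> 'a" and sB :: "'f \<Rightarrow> 'b::ab_group_add \<Rightarrow> 'b"
  assumes "vector_space sA" "vector_space sB"
    and "t \<in> range (tensor_class sA sB)" "t' \<in> range (tensor_class sA sB)"
    and eq: "\<And>f. bilinear_map sA sB (*) f \<Longrightarrow> sweedler (*) f t = sweedler (*) f t'"
  shows "t = t'"
proof -
  obtain u v where t: "t = tensor_class sA sB u" "t' = tensor_class sA sB v" using assms(3,4) by blast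
  have "u - v \<in> free.span (tensor_relators sA sB)"
  proof (rule ccontr)
    assume "u - v \<notin> free.span (tensor_relators sA sB)"
    then obtain L where L: "Vector_Spaces.linear free_scale (*) L"
      "\<And>r. r \<in> free.span (tensor_relators sA sB) \<Longrightarrow> L r = 0" "L (u - v) \<noteq> 0"
      using separating_functional[OF free.vector_space_axioms] by metis
    interpret L: Vector_Spaces.linear free_scale "(*)" L by (rule L)
    have rel: "L r = 0" if "r \<in> tensor_relators sA sB" for r
      using L(2) free.span_base that by blast
    let ?f = "\<lambda>a b. L (free_gen (a, b))"
    have "?f (a + a') b = ?f a b + ?f a' b" for a a' b
      using rel[OF tensor_relatorI(1)[of a a' b]] unfolding L.diff by (simp add: diff_diff_eq)
    moreover have "?f a (b + b') = ?f a b + ?f a b'" for a b b'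
      using rel[OF tensor_relatorI(2)[of a b b']] unfolding L.diff by (simp add: diff_diff_eq)
    moreover have "?f (sA c a) b = c * ?f a b" for a b c
      using rel[OF tensor_relatorI(3)[of sA c a b]] by (simp add: L.diff L.scale)
    moreover have "?f a (sB c b) = c * ?f a b" for a b c
      using rel[OF tensor_relatorI(4)[of a sB c b]] by (simp add: L.diff L.scale)
    ultimately have bil: "bilinear_map sA sB (*) ?f"
      by (intro bilinear_mapI) (simp_all add: Vector_Spaces.linear_iff assms(1,2) vector_space_field)
    have "L w = sweedler (*) ?f (tensor_class sA sB w)" for w
      unfolding sweedler_class[OF bil] case_prod_unfold prod.collapse
      using L(1) by (rule linear_eq_free_extend)
    then have "L u = L v" using eq[OF bil] t by metis
    then show False using L(3) by (simp add: L.diff)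
  qed
  then show ?thesis unfolding t by (rule tensor_class_eqI)
qed

lemma tensor3_eqI:
  fixes sA :: "'f::field \<Rightarrow> 'a::ab_group_add \<Rightarrow> 'a" and sB :: "'f \<Rightarrow> 'b::ab_group_add \<Rightarrow> 'b"
    and sC :: "'f \<Rightarrow> 'c::ab_group_add \<Rightarrow> 'c"
  assumes "vector_space sA" "vector_space sB" "vector_space sC"
    and "t \<in> range (tensor3_class sA sB sC)" "t' \<in> range (tensor3_class sA sB sC)"
    and eq: "\<And>f. trilinear_map sA sB sC (*) f \<Longrightarrow> sweedler3 (*) f t = sweedler3 (*) f t'"
  shows "t = t'"
proof -
  obtain u v where t: "t = tensor3_class sA sB sC u" "t' = tensor3_class sA sB sC v"
    using assms(4,5) by blast
  let ?R = "tensor3_relators sA sB sC"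
  have "u - v \<in> free.span ?R"
  proof (rule ccontr)
    assume "u - v \<notin> free.span ?R"
    then obtain L where L: "Vector_Spaces.linear free_scale (*) L"
      "\<And>r. r \<in> free.span ?R \<Longrightarrow> L r = 0" "L (u - v) \<noteq> 0"
      using separating_functional[OF free.vector_space_axioms] by metis
    interpret L: Vector_Spaces.linear free_scale "(*)" L by (rule L)
    have rel: "L r = 0" if "r \<in> ?R" for r
      using L(2) free.span_base that by blast
    let ?f = "\<lambda>a b c. L (free_gen (a, b, c))"
    have "?f (a + a') b c = ?f a b c + ?f a' b c" for a a' b c
      using rel[OF tensor3_relatorI(1)[of a a' b c]] unfolding L.diff by (simp add: diff_diff_eq)
    moreover have "?f a (b + b') c = ?f a b c + ?f a b' c" for a b b' c
      using rel[OF tensor3_relatorI(2)[of a b b' c]] unfolding L.diff by (simp add: diff_diff_eq)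
    moreover have "?f a b (c + c') = ?f a b c + ?f a b c'" for a b c c'
      using rel[OF tensor3_relatorI(3)[of a b c c']] unfolding L.diff by (simp add: diff_diff_eq)
    moreover have "?f (sA r a) b c = r * ?f a b c" for a b c r
      using rel[OF tensor3_relatorI(4)[of sA r a b c]] by (simp add: L.diff L.scale)
    moreover have "?f a (sB r b) c = r * ?f a b c" for a b c r
      using rel[OF tensor3_relatorI(5)[of a sB r b c]] by (simp add: L.diff L.scale)
    moreover have "?f a b (sC r c) = r * ?f a b c" for a b c r
      using rel[OF tensor3_relatorI(6)[of a b sC r c]] by (simp add: L.diff L.scale)
    ultimately have tri: "trilinear_map sA sB sC (*) ?f"
      by (intro trilinear_mapI) (simp_all add: Vector_Spaces.linear_iff assms(1-3) vector_space_field)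
    have "L w = sweedler3 (*) ?f (tensor3_class sA sB sC w)" for w
      unfolding sweedler3_class[OF tri] case_prod_unfold prod.collapse
      using L(1) by (rule linear_eq_free_extend)
    then have "L u = L v" using eq[OF tri] t by metis
    then show False using L(3) by (simp add: L.diff)
  qed
  then show ?thesis unfolding t by (rule tensor3_class_eqI)
qed

section \<open>Linearity and interchange of Sweedler sums\<close>

text \<open>\<open>linear_to_tensor\<close> is phrased by cosets of chosen representatives;
  evaluation at a bilinear map makes the choice irrelevant and leaves ordinary linearity.\<close>

lemma linear_sweedler_of_linear_to_tensor:
  assumes "linear_to_tensor sV sA sB F" "vector_space sV" "bilinear_map sA sB sW f"
  shows "Vector_Spaces.linear sV sW (\<lambda>v. sweedler sW f (F v))"
proof -
  interpret E: Vector_Spaces.linear free_scale sW "free_extend sW (\<lambda>(a, b). f a b)"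
    using bilinear_mapD(3)[OF assms(3)] by (rule linear_free_extend)
  have "sweedler sW f (F (v + w)) = sweedler sW f (F v) + sweedler sW f (F w)" for v w
  proof -
    have "sweedler sW f (F (v + w)) = sweedler sW f (tensor_class sA sB (tensor_rep (F v) + tensor_rep (F w)))"
      using assms(1) by (metis linear_to_tensor_def)
    then show ?thesis unfolding sweedler_class[OF assms(3)] by (simp add: sweedler_def E.add)
  qed
  moreover have "sweedler sW f (F (sV c v)) = sW c (sweedler sW f (F v))" for c v
  proof -
    have "sweedler sW f (F (sV c v)) = sweedler sW f (tensor_class sA sB (free_scale c (tensor_rep (F v))))"
      using assms(1) by (metis linear_to_tensor_def)
    then show ?thesis unfolding sweedler_class[OF assms(3)] by (simp add: sweedler_def E.scale)
  qed
  ultimately show ?thesis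
    by (simp add: Vector_Spaces.linear_iff assms(2) bilinear_mapD(3)[OF assms(3)])
qed

text \<open>A converse: additivity and homogeneity of \<open>F\<close> can be tested on bilinear
  functionals, because these separate tensors.\<close>

lemma linear_to_tensorI:
  fixes sA :: "'f::field \<Rightarrow> 'a::ab_group_add \<Rightarrow> 'a" and sB :: "'f \<Rightarrow> 'b::ab_group_add \<Rightarrow> 'b"
  assumes "vector_space sA" "vector_space sB" "\<And>v. F v \<in> range (tensor_class sA sB)"
    and lin: "\<And>f. bilinear_map sA sB (*) f \<Longrightarrow> Vector_Spaces.linear sV (*) (\<lambda>v. sweedler (*) f (F v))"
  shows "linear_to_tensor sV sA sB F"
  unfolding linear_to_tensor_def
proof (intro conjI allI)
  show "F v \<in> range (tensor_class sA sB)" for v by fact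
  show "F (v + w) = tensor_class sA sB (tensor_rep (F v) + tensor_rep (F w))" for v w
  proof (rule tensor_eqI[OF assms(1,2,3)])
    fix f assume f: "bilinear_map sA sB (*) f"
    interpret E: Vector_Spaces.linear free_scale "(*)" "free_extend (*) (\<lambda>(a, b). f a b)"
      using bilinear_mapD(3)[OF f] by (rule linear_free_extend)
    show "sweedler (*) f (F (v + w))
      = sweedler (*) f (tensor_class sA sB (tensor_rep (F v) + tensor_rep (F w)))"
      unfolding sweedler_class[OF f] linearD(3)[OF lin[OF f]] by (simp add: sweedler_def E.add)
  qed simp
  show "F (sV c v) = tensor_class sA sB (free_scale c (tensor_rep (F v)))" for c v
  proof (rule tensor_eqI[OF assms(1,2,3)])
    fix f assume f: "bilinear_map sA sB (*) f"
    interpret E: Vector_Spaces.linear free_scale "(*)" "free_extend (*) (\<lambda>(a, b). f a b)"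
      using bilinear_mapD(3)[OF f] by (rule linear_free_extend)
    show "sweedler (*) f (F (sV c v)) = sweedler (*) f (tensor_class sA sB (free_scale c (tensor_rep (F v))))"
      unfolding sweedler_class[OF f] linearD(4)[OF lin[OF f]] by (simp add: sweedler_def E.scale)
  qed simp
qed

lemma linear_sweedler:
  assumes "Vector_Spaces.linear sV sW L"
  shows "L (sweedler sV f t) = sweedler sW (\<lambda>a b. L (f a b)) t"
  by (simp add: sweedler_def linear_free_extend_comp[OF assms] case_prod_unfold)

text \<open>For a fixed tensor the sum is a finite combination with fixed coefficients, so linearity
  in a parameter is inherited from the terms. When the tensor itself varies,
  \<open>linear_comult\<close> takes over.\<close>

lemma linear_sweedler_param:
  assumes "\<And>p q. Vector_Spaces.linear sX sV (\<lambda>x. g x p q)"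
  shows "Vector_Spaces.linear sX sV (\<lambda>x. sweedler sV (\<lambda>p q. g x p q) t)"
  using linearD(1,2)[OF assms] unfolding sweedler_def free_extend_def
  by (intro linear_sum) (auto simp: assms intro!: linear_scale_right)

lemma sweedler_swap:
  assumes "vector_space sV"
  shows "sweedler sV (\<lambda>a b. sweedler sV (\<lambda>c d. f a b c d) t') t
    = sweedler sV (\<lambda>c d. sweedler sV (\<lambda>a b. f a b c d) t) t'"
proof -
  interpret vector_space sV by fact
  show ?thesis
    unfolding sweedler_def free_extend_def case_prod_unfold scale_sum_right
    by (subst sum.swap) (simp add: mult.commute)
qed

section \<open>Sweedler calculus in coalgebras\<close>

lemma linear_bilinear_left:
  assumes "bilinear_map sA sB sC f" "Vector_Spaces.linear sX sA h"
  shows "Vector_Spaces.linear sX sC (\<lambda>x. f (h x) b)"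
  using bilinear_mapD(2)[OF assms(1)] assms(2) by (rule linear_comp)

lemma linear_bilinear_right:
  assumes "bilinear_map sA sB sC f" "Vector_Spaces.linear sX sB h"
  shows "Vector_Spaces.linear sX sC (\<lambda>x. f a (h x))"
  using bilinear_mapD(1)[OF assms(1)] assms(2) by (rule linear_comp)

lemma linear_comult:
  assumes "coalgebra sC \<Delta> \<epsilon>" "bilinear_map sC sC sV f" "Vector_Spaces.linear sX sC h"
  shows "Vector_Spaces.linear sX sV (\<lambda>x. sweedler sV f (\<Delta> (h x)))"
proof -
  interpret coalgebra sC \<Delta> \<epsilon> by fact
  have "Vector_Spaces.linear sC sV (\<lambda>x. sweedler sV f (\<Delta> x))"
    using comult_linear vector_space_axioms assms(2) by (rule linear_sweedler_of_linear_to_tensor)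
  then show ?thesis using assms(3) by (rule linear_comp)
qed

lemma sweedler_coassoc:
  assumes "coalgebra sC \<Delta> \<epsilon>" "trilinear_map sC sC sC sV f"
  shows "sweedler sV (\<lambda>x1 x2. sweedler sV (\<lambda>y z. f y z x2) (\<Delta> x1)) (\<Delta> x)
    = sweedler sV (\<lambda>x1 x2. sweedler sV (\<lambda>y z. f x1 y z) (\<Delta> x2)) (\<Delta> x)"
proof -
  interpret coalgebra sC \<Delta> \<epsilon> by fact
  show ?thesis
    using arg_cong[OF coassoc[of x], of "sweedler3 sV f"]
    by (simp add: sweedler3_sweedler_tensor3[OF assms(2)] sweedler3_tensor3[OF assms(2)])
qed

lemma sweedler_counit_left:
  assumes "coalgebra sC \<Delta> \<epsilon>" "Vector_Spaces.linear sC sV g"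
  shows "sweedler sV (\<lambda>x1 x2. sV (\<epsilon> x1) (g x2)) (\<Delta> x) = g x"
proof -
  interpret coalgebra sC \<Delta> \<epsilon> by fact
  show ?thesis
    using arg_cong[OF counit_left[of x], of g] by (simp add: linear_sweedler[OF assms(2)] linearD(4)[OF assms(2)])
qed

section \<open>Sweedler sums over the tensor product of two coalgebras\<close>

text \<open>This is evaluation on the comultiplication of \<open>a \<otimes> b\<close> in the tensor
  product coalgebra, with the first legs of both arguments listed before the second ones. It allows
  maps in two variables to be convolved without a coalgebra structure on a type of tensors.\<close>

definition sweedler2 ::
  "('f::field \<Rightarrow> 'v::ab_group_add \<Rightarrow> 'v) \<Rightarrow> ('a \<Rightarrow> ('f, 'a, 'a) tensor) \<Rightarrow> ('b \<Rightarrow> ('f, 'b, 'b) tensor)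
    \<Rightarrow> ('a \<Rightarrow> 'b \<Rightarrow> 'a \<Rightarrow> 'b \<Rightarrow> 'v) \<Rightarrow> 'a \<Rightarrow> 'b \<Rightarrow> 'v" where
  "sweedler2 sV \<Delta>A \<Delta>B f a b =
    sweedler sV (\<lambda>a1 a2. sweedler sV (\<lambda>b1 b2. f a1 b1 a2 b2) (\<Delta>B b)) (\<Delta>A a)"

lemma linear_sweedler2:
  assumes "Vector_Spaces.linear sV sW L"
  shows "L (sweedler2 sV \<Delta>A \<Delta>B f a b) = sweedler2 sW \<Delta>A \<Delta>B (\<lambda>a1 b1 a2 b2. L (f a1 b1 a2 b2)) a b"
  by (simp add: sweedler2_def linear_sweedler[OF assms])

lemma linear_sweedler2_param:
  assumes "\<And>a1 b1 a2 b2. Vector_Spaces.linear sX sV (\<lambda>x. f x a1 b1 a2 b2)"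
  shows "Vector_Spaces.linear sX sV (\<lambda>x. sweedler2 sV \<Delta>A \<Delta>B (\<lambda>a1 b1 a2 b2. f x a1 b1 a2 b2) a b)"
  unfolding sweedler2_def by (intro linear_sweedler_param assms)

lemma linear_sweedler2_left:
  assumes "coalgebra sA \<Delta>A \<epsilon>A" "\<And>b1 b2. bilinear_map sA sA sV (\<lambda>a1 a2. f a1 b1 a2 b2)"
    "Vector_Spaces.linear sX sA h"
  shows "Vector_Spaces.linear sX sV (\<lambda>x. sweedler2 sV \<Delta>A \<Delta>B f (h x) b)"
  unfolding sweedler2_def
  by (intro linear_comult[OF assms(1)] bilinear_mapI linear_sweedler_param assms(3)
      bilinear_mapD[OF assms(2)])

lemma linear_sweedler2_right:
  assumes "coalgebra sB \<Delta>B \<epsilon>B" "\<And>a1 a2. bilinear_map sB sB sV (\<lambda>b1 b2. f a1 b1 a2 b2)"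
    "Vector_Spaces.linear sX sB h"
  shows "Vector_Spaces.linear sX sV (\<lambda>x. sweedler2 sV \<Delta>A \<Delta>B f a (h x))"
  unfolding sweedler2_def
  by (intro linear_sweedler_param linear_comult[OF assms(1)] bilinear_mapI assms(3)
      bilinear_mapD[OF assms(2)])

lemma sweedler_sweedler2_swap:
  assumes "vector_space sV"
  shows "sweedler sV (\<lambda>c1 c2. sweedler2 sV \<Delta>A \<Delta>B (\<lambda>a1 b1 a2 b2. f c1 c2 a1 b1 a2 b2) a b) t
    = sweedler2 sV \<Delta>A \<Delta>B (\<lambda>a1 b1 a2 b2. sweedler sV (\<lambda>c1 c2. f c1 c2 a1 b1 a2 b2) t) a b"
  unfolding sweedler2_def sweedler_swap[OF assms, where t = t] ..

lemma sweedler2_swap: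
  assumes "vector_space sV"
  shows "sweedler2 sV \<Delta>A \<Delta>B (\<lambda>a1 b1 a2 b2. sweedler2 sV \<Delta>C \<Delta>D (\<lambda>c1 d1 c2 d2. f a1 b1 a2 b2 c1 d1 c2 d2) c d) a b
    = sweedler2 sV \<Delta>C \<Delta>D (\<lambda>c1 d1 c2 d2. sweedler2 sV \<Delta>A \<Delta>B (\<lambda>a1 b1 a2 b2. f a1 b1 a2 b2 c1 d1 c2 d2) a b) c d"
proof -
  have "sweedler sV (\<lambda>b1 b2. sweedler2 sV \<Delta>C \<Delta>D (\<lambda>c1 d1 c2 d2. f a1 b1 a2 b2 c1 d1 c2 d2) c d) t
    = sweedler2 sV \<Delta>C \<Delta>D (\<lambda>c1 d1 c2 d2. sweedler sV (\<lambda>b1 b2. f a1 b1 a2 b2 c1 d1 c2 d2) t) c d" for a1 a2 t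
    using assms by (rule sweedler_sweedler2_swap)
  then show ?thesis
    by (simp add: sweedler2_def[of sV \<Delta>A] sweedler_sweedler2_swap[OF assms])
qed

text \<open>The sums are reordered so that the two coproducts taken in \<open>B\<close> become
  adjacent; coassociativity is then applied in \<open>B\<close>, next in \<open>A\<close>, and the
  order is restored.\<close>

lemma sweedler2_coassoc:
  assumes A: "coalgebra sA \<Delta>A \<epsilon>A" and B: "coalgebra sB \<Delta>B \<epsilon>B"
    and fA: "\<And>b1 b2 b3. trilinear_map sA sA sA sV (\<lambda>a1 a2 a3. f a1 b1 a2 b2 a3 b3)"
    and fB: "\<And>a1 a2 a3. trilinear_map sB sB sB sV (\<lambda>b1 b2 b3. f a1 b1 a2 b2 a3 b3)"
  shows "sweedler2 sV \<Delta>A \<Delta>B (\<lambda>a1 b1 a2 b2. sweedler2 sV \<Delta>A \<Delta>B (\<lambda>x y z w. f x y z w a2 b2) a1 b1) a b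
    = sweedler2 sV \<Delta>A \<Delta>B (\<lambda>a1 b1 a2 b2. sweedler2 sV \<Delta>A \<Delta>B (\<lambda>x y z w. f a1 b1 x y z w) a2 b2) a b"
proof -
  have V: "vector_space sV" using fA by (rule trilinear_mapD)
  let ?S = "sweedler sV"
  have "sweedler2 sV \<Delta>A \<Delta>B (\<lambda>a1 b1 a2 b2. sweedler2 sV \<Delta>A \<Delta>B (\<lambda>x y z w. f x y z w a2 b2) a1 b1) a b
    = ?S (\<lambda>a1 a2. ?S (\<lambda>x z. ?S (\<lambda>b1 b2. ?S (\<lambda>y w. f x y z w a2 b2) (\<Delta>B b1)) (\<Delta>B b)) (\<Delta>A a1)) (\<Delta>A a)"
    unfolding sweedler2_def by (subst sweedler_swap[OF V]) (rule refl)
  also have "\<dots> = ?S (\<lambda>a1 a2. ?S (\<lambda>x z. ?S (\<lambda>b1 b2. ?S (\<lambda>y w. f x b1 z y a2 w) (\<Delta>B b2)) (\<Delta>B b)) (\<Delta>A a1)) (\<Delta>A a)"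
    by (subst sweedler_coassoc[OF B fB]) (rule refl)
  also have "\<dots> = ?S (\<lambda>a1 a2. ?S (\<lambda>x z. ?S (\<lambda>b1 b2. ?S (\<lambda>y w. f a1 b1 x y z w) (\<Delta>B b2)) (\<Delta>B b)) (\<Delta>A a2)) (\<Delta>A a)"
    by (rule sweedler_coassoc[OF A]) (intro trilinear_mapI linear_sweedler_param trilinear_mapD[OF fA])
  also have "\<dots> = sweedler2 sV \<Delta>A \<Delta>B (\<lambda>a1 b1 a2 b2. sweedler2 sV \<Delta>A \<Delta>B (\<lambda>x y z w. f a1 b1 x y z w) a2 b2) a b"
    unfolding sweedler2_def by (subst (2) sweedler_swap[OF V]) (rule refl)
  finally show ?thesis .
qed

lemma sweedler2_counit_left:
  assumes A: "coalgebra sA \<Delta>A \<epsilon>A" and B: "coalgebra sB \<Delta>B \<epsilon>B" and g: "bilinear_map sA sB sV g"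
  shows "sweedler2 sV \<Delta>A \<Delta>B (\<lambda>a1 b1 a2 b2. sV (\<epsilon>A a1 * \<epsilon>B b1) (g a2 b2)) a b = g a b"
proof -
  interpret vector_space sV using g by (rule bilinear_mapD)
  have "Vector_Spaces.linear sB sV (\<lambda>b. sV (\<epsilon>A a1) (g a2 b))" for a1 a2
    using bilinear_mapD(1)[OF g] by (rule linear_scale_right)
  from sweedler_counit_left[OF B this] show ?thesis
    by (simp add: sweedler2_def sweedler_counit_left[OF A bilinear_mapD(2)[OF g]] mult.commute)
qed

lemma sweedler_comult_mult:
  assumes "bialgebra sA \<Delta> \<epsilon>" "bilinear_map sA sA sV f"
  shows "sweedler sV f (\<Delta> (x * y)) = sweedler2 sV \<Delta> \<Delta> (\<lambda>x1 y1 x2 y2. f (x1 * y1) (x2 * y2)) x y"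
proof -
  interpret bialgebra sA \<Delta> \<epsilon> by fact
  show ?thesis
    by (simp add: comult_mult sweedler2_def sweedler_sweedler_tensor[OF assms(2)] sweedler_tensor[OF assms(2)])
qed

lemma sweedler_comult_one:
  assumes "bialgebra sA \<Delta> \<epsilon>" "bilinear_map sA sA sV f"
  shows "sweedler sV f (\<Delta> 1) = f 1 1"
proof -
  interpret bialgebra sA \<Delta> \<epsilon> by fact
  show ?thesis by (simp add: comult_one sweedler_tensor[OF assms(2)])
qed

lemma sweedler_coalgebra_action:
  assumes "coalgebra_action \<Delta>C \<epsilon>C \<Delta>D \<epsilon>D sE \<Delta>E \<epsilon>E act" "bilinear_map sE sE sV f"
  shows "sweedler sV f (\<Delta>E (act x y)) = sweedler2 sV \<Delta>C \<Delta>D (\<lambda>x1 y1 x2 y2. f (act x1 y1) (act x2 y2)) x y"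
  using assms(1)
  by (simp add: coalgebra_action_def sweedler2_def sweedler_sweedler_tensor[OF assms(2)] sweedler_tensor[OF assms(2)])

section \<open>Canonical Doi-Hopf modules\<close>

lemma left_comodule_comult:
  assumes "coalgebra sC \<Delta> \<epsilon>"
  shows "left_comodule sC \<Delta> \<epsilon> sC \<Delta>"
proof -
  interpret coalgebra sC \<Delta> \<epsilon> by fact
  show ?thesis
    by unfold_locales (fact comult_linear coassoc counit_left)+
qed

text \<open>The regular coaction of \<open>A\<close> is pushed forward along the coalgebra map
  \<open>f\<close> in its left leg; its axioms come from those of the coalgebra
  \<open>A\<close>.\<close>

lemma left_comodule_hom:
  assumes C: "coalgebra sC \<Delta>C \<epsilon>C" and A: "coalgebra sA \<Delta>A \<epsilon>A" and f: "Vector_Spaces.linear sA sC f"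
    and comult: "\<And>x. \<Delta>C (f x) = tensor_map sC sC f f (\<Delta>A x)" and counit: "\<And>x. \<epsilon>C (f x) = \<epsilon>A x"
  shows "left_comodule sC \<Delta>C \<epsilon>C sA (coact_hom sC sA \<Delta>A f)"
proof -
  interpret C: coalgebra sC \<Delta>C \<epsilon>C by fact
  interpret A: coalgebra sA \<Delta>A \<epsilon>A by fact
  note vs = C.vector_space_axioms A.vector_space_axioms
  have S: "sweedler sV g (coact_hom sC sA \<Delta>A f x) = sweedler sV (\<lambda>p q. g (f p) q) (\<Delta>A x)"
    if "bilinear_map sC sA sV g" for g :: "'b \<Rightarrow> 'c \<Rightarrow> 'v::ab_group_add" and sV x
    by (simp add: coact_hom_def sweedler_tensor_map[OF that])
  have SC: "sweedler sV g (\<Delta>C (f x)) = sweedler sV (\<lambda>p q. g (f p) (f q)) (\<Delta>A x)"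
    if "bilinear_map sC sC sV g" for g :: "'b \<Rightarrow> 'b \<Rightarrow> 'v::ab_group_add" and sV x
    by (simp add: comult sweedler_tensor_map[OF that])
  show ?thesis
  proof (unfold_locales)
    show "linear_to_tensor sA sC sA (coact_hom sC sA \<Delta>A f)"
    proof (rule linear_to_tensorI[OF vs])
      fix g :: "'b \<Rightarrow> 'c \<Rightarrow> 'a" assume g: "bilinear_map sC sA (*) g"
      show "Vector_Spaces.linear sA (*) (\<lambda>x. sweedler (*) g (coact_hom sC sA \<Delta>A f x))"
        unfolding S[OF g]
        by (intro linear_comult[OF A] bilinear_mapI bilinear_mapD(1)[OF g] linear_bilinear_left[OF g f]
            linear_ident vs)
    qed (simp add: coact_hom_def)
    show "sweedler_tensor3 sC sC sA
          (\<lambda>c m0. sweedler_tensor3 sC sC sA (\<lambda>c1 c2. tensor3 sC sC sA c1 c2 m0) (\<Delta>C c)) (coact_hom sC sA \<Delta>A f m)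
        = sweedler_tensor3 sC sC sA
          (\<lambda>c m0. sweedler_tensor3 sC sC sA (\<lambda>d m00. tensor3 sC sC sA c d m00) (coact_hom sC sA \<Delta>A f m0))
          (coact_hom sC sA \<Delta>A f m)" for m
    proof (rule tensor3_eqI[OF vs(1,1,2)])
      fix g :: "'b \<Rightarrow> 'b \<Rightarrow> 'c \<Rightarrow> 'a" assume g: "trilinear_map sC sC sA (*) g"
      note g1 = trilinear_mapD(1)[OF g] and g2 = trilinear_mapD(2)[OF g] and g3 = trilinear_mapD(3)[OF g]
      have "sweedler (*) (\<lambda>c m0. sweedler (*) (\<lambda>c1 c2. g c1 c2 m0) (\<Delta>C c)) (coact_hom sC sA \<Delta>A f m)
        = sweedler (*) (\<lambda>p q. sweedler (*) (\<lambda>c1 c2. g c1 c2 q) (\<Delta>C (f p))) (\<Delta>A m)"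
        by (rule S) (intro bilinear_mapI linear_sweedler_param g1 g2 g3 linear_comult[OF C] linear_ident vs)
      \<comment> \<open>As \<open>f\<close> is a coalgebra map, the coproduct of \<open>f p\<close>
        can be taken before applying \<open>f\<close>; coassociativity in \<open>A\<close> is then
        available.\<close>
      also have "\<dots> = sweedler (*) (\<lambda>p q. sweedler (*) (\<lambda>x y. g (f x) (f y) q) (\<Delta>A p)) (\<Delta>A m)"
        by (subst SC) (intro bilinear_mapI g1 g2 g3, rule refl)
      also have "\<dots> = sweedler (*) (\<lambda>p q. sweedler (*) (\<lambda>x y. g (f p) (f x) y) (\<Delta>A q)) (\<Delta>A m)"
        by (rule sweedler_coassoc[OF A])
          (intro trilinear_mapI linear_comp[OF g1 f] linear_comp[OF g2 f] g3)
      also have "\<dots> = sweedler (*) (\<lambda>p q. sweedler (*) (\<lambda>d m00. g (f p) d m00) (coact_hom sC sA \<Delta>A f q)) (\<Delta>A m)"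
        by (subst S) (intro bilinear_mapI g1 g2 g3, rule refl)
      also have "\<dots> = sweedler (*) (\<lambda>c m0. sweedler (*) (\<lambda>d m00. g c d m00) (coact_hom sC sA \<Delta>A f m0))
          (coact_hom sC sA \<Delta>A f m)"
      proof (rule S[symmetric])
        have "Vector_Spaces.linear sA (*) (\<lambda>q. sweedler (*) (\<lambda>d m00. g c d m00) (coact_hom sC sA \<Delta>A f q))" for c
          by (subst S) (intro bilinear_mapI linear_comult[OF A] linear_ident vs g2 g3 linear_comp[OF g2 f])+
        then show "bilinear_map sC sA (*) (\<lambda>c m0. sweedler (*) (\<lambda>d m00. g c d m00) (coact_hom sC sA \<Delta>A f m0))"
          by (intro bilinear_mapI linear_sweedler_param g1)
      qed
      finally show "sweedler3 (*) g (sweedler_tensor3 sC sC sA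
          (\<lambda>c m0. sweedler_tensor3 sC sC sA (\<lambda>c1 c2. tensor3 sC sC sA c1 c2 m0) (\<Delta>C c)) (coact_hom sC sA \<Delta>A f m))
        = sweedler3 (*) g (sweedler_tensor3 sC sC sA
          (\<lambda>c m0. sweedler_tensor3 sC sC sA (\<lambda>d m00. tensor3 sC sC sA c d m00) (coact_hom sC sA \<Delta>A f m0))
          (coact_hom sC sA \<Delta>A f m))"
        by (simp add: sweedler3_sweedler_tensor3[OF g] sweedler3_tensor3[OF g])
    qed simp_all
    show "sweedler sA (\<lambda>c m0. sA (\<epsilon>C c) m0) (coact_hom sC sA \<Delta>A f m) = m" for m
    proof -
      have "sweedler sA (\<lambda>c m0. sA (\<epsilon>C c) m0) (coact_hom sC sA \<Delta>A f m)
        = sweedler sA (\<lambda>p q. sA (\<epsilon>C (f p)) q) (\<Delta>A m)"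
        by (rule S) (intro bilinear_mapI linear_scale_left linear_scale_right linear_ident vs C.counit_linear)
      then show ?thesis by (simp add: counit A.counit_left)
    qed
  qed
qed

lemma left_comodule_algebra_comult:
  assumes "hopf_algebra sB \<Delta> \<epsilon> S"
  shows "left_comodule_algebra sB \<Delta> \<epsilon> S sB \<Delta>"
proof -
  interpret hopf_algebra sB \<Delta> \<epsilon> S by fact
  interpret left_comodule sB \<Delta> \<epsilon> sB \<Delta>
    using coalgebra_axioms by (rule left_comodule_comult)
  show ?thesis by unfold_locales (fact comult_mult comult_one)+
qed

text \<open>For the regular coactions, the Doi-Hopf compatibility says precisely that the action
  commutes with comultiplication.\<close>

lemma doi_hopf_module_module_coalgebra:
  assumes "right_module_coalgebra sB \<Delta>B \<epsilon>B SB sC \<Delta>C \<epsilon>C act"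
  shows "doi_hopf_module sB \<Delta>B \<epsilon>B SB sB \<Delta>B sC \<Delta>C \<epsilon>C act sC act \<Delta>C"
proof -
  interpret right_module_coalgebra sB \<Delta>B \<epsilon>B SB sC \<Delta>C \<epsilon>C act by fact
  interpret A: left_comodule_algebra sB \<Delta>B \<epsilon>B SB sB \<Delta>B
    using B.hopf_algebra_axioms by (rule left_comodule_algebra_comult)
  interpret M: left_comodule sC \<Delta>C \<epsilon>C sC \<Delta>C
    using C.coalgebra_axioms by (rule left_comodule_comult)
  show ?thesis
    using act_module act_coalgebra by unfold_locales (simp_all add: coalgebra_action_def)
qed

section \<open>Matched pairs with a homomorphism\<close>

lemma linear_mult:
  assumes "unital_algebra sA" "Vector_Spaces.linear sX sA f"
  shows "Vector_Spaces.linear sX sA (\<lambda>x. f x * c)" "Vector_Spaces.linear sX sA (\<lambda>x. c * f x)"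
proof -
  interpret unital_algebra sA by fact
  show "Vector_Spaces.linear sX sA (\<lambda>x. f x * c)" "Vector_Spaces.linear sX sA (\<lambda>x. c * f x)"
    using assms(2)
    by (simp_all add: Vector_Spaces.linear_iff scale_mult_left scale_mult_right distrib_left distrib_right)
qed

locale matched_pair_hom = matched_pair sH \<Delta>H \<epsilon>H SH sK \<Delta>K \<epsilon>K SK lact ract
  for sH :: "'f::field \<Rightarrow> 'h::{ring, monoid_mult} \<Rightarrow> 'h" and \<Delta>H \<epsilon>H SH
    and sK :: "'f \<Rightarrow> 'k::{ring, monoid_mult} \<Rightarrow> 'k" and \<Delta>K \<epsilon>K SK
    and lact :: "'h \<Rightarrow> 'k \<Rightarrow> 'k" (infixr "\<rightharpoonup>" 75)
    and ract :: "'h \<Rightarrow> 'k \<Rightarrow> 'h" (infixl "\<leftharpoonup>" 75) +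
  fixes \<pi> :: "'k \<Rightarrow> 'h"
  assumes \<pi>_hom: "hopf_algebra_hom sK \<Delta>K \<epsilon>K sH \<Delta>H \<epsilon>H \<pi>"
    and \<pi>_lact_ract:
      "sweedler sH (\<lambda>x1 x2. sweedler sH (\<lambda>a1 a2. \<pi> (x1 \<rightharpoonup> a1) * (x2 \<leftharpoonup> a2)) (\<Delta>K a)) (\<Delta>H x) = x * \<pi> a"
begin

abbreviation F where "F a b \<equiv> \<pi> a \<rightharpoonup> b"
abbreviation G where "G a b \<equiv> ract_hom sK \<Delta>K SK lact \<pi> a b"
abbreviation DK where "DK sV f a \<equiv> sweedler sV f (\<Delta>K a)"
abbreviation DKK where "DKK sV f a b \<equiv> sweedler2 sV \<Delta>K \<Delta>K f a b"

lemmas coalgK = L.C.coalgebra_axioms and coalgH = L.B.coalgebra_axioms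
  and hopfK = R.B.hopf_algebra_axioms
  and bialgK = R.B.bialgebra_axioms
  and algK = R.B.unital_algebra_axioms and algH = L.B.unital_algebra_axioms
  and vsK = L.C.vector_space_axioms and vsH = L.B.vector_space_axioms

lemma \<pi>_simps: "\<pi> (a * b) = \<pi> a * \<pi> b" "\<pi> 1 = 1" "\<epsilon>H (\<pi> a) = \<epsilon>K a" "\<Delta>H (\<pi> a) = tensor_map sH sH \<pi> \<pi> (\<Delta>K a)"
  and \<pi>_linear: "Vector_Spaces.linear sK sH \<pi>"
  using \<pi>_hom by (simp_all add: hopf_algebra_hom_def)

lemma lact_bilinear: "bilinear_map sH sK sK lact"
  using L.act_module by (auto simp: left_module_def)

lemma ract_bilinear: "bilinear_map sH sK sH ract"
  using R.act_module by (auto simp: right_module_def)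

lemma lact_counit: "\<epsilon>K (x \<rightharpoonup> a) = \<epsilon>H x * \<epsilon>K a"
  using L.act_coalgebra by (auto simp: coalgebra_action_def)

text \<open>There is one closure rule for each operation occurring in the Sweedler expressions
  below, so multilinearity follows by descending through a term to its variables.\<close>

lemmas lin0 =
  linear_ident[OF vsK] linear_ident[OF vsH] linear_ident[OF vector_space_field]
  linear_mult[OF algK] linear_mult[OF algH]
  linear_comp[OF \<pi>_linear] linear_comp[OF R.B.antipode_linear]
  linear_comp[OF L.C.counit_linear] linear_comp[OF L.B.counit_linear]
  linear_bilinear_left[OF lact_bilinear] linear_bilinear_right[OF lact_bilinear]
  linear_bilinear_left[OF ract_bilinear] linear_bilinear_right[OF ract_bilinear]
  linear_scale_right[where sB = sK] linear_scale_right[where sB = sH] linear_scale_right[where sB = "(*)"]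
  linear_sweedler_param linear_sweedler2_param
  linear_comult[OF coalgK] linear_comult[OF coalgH]
  linear_sweedler2_left[OF coalgK] linear_sweedler2_right[OF coalgK]
  bilinear_mapI trilinear_mapI

lemma G_linear_left: "Vector_Spaces.linear sX sK h \<Longrightarrow> Vector_Spaces.linear sX sK (\<lambda>x. G (h x) b)"
  and G_linear_right: "Vector_Spaces.linear sX sK h \<Longrightarrow> Vector_Spaces.linear sX sK (\<lambda>x. G a (h x))"
  unfolding ract_hom_def by (intro lin0; assumption)+

lemmas lin = lin0 G_linear_left G_linear_right

lemma G_eq: "G a b = DKK sK (\<lambda>a1 b1 a2 b2. SK (F a1 b1) * (a2 * b2)) a b"
  by (simp add: ract_hom_def sweedler2_def mult.assoc)

section \<open>Passage from sums over \<open>H\<close> to sums over \<open>K\<close>\<close>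

lemma sweedler_comult_hom:
  assumes "bilinear_map sH sH sV f"
  shows "sweedler sV f (\<Delta>H (\<pi> a)) = DK sV (\<lambda>a1 a2. f (\<pi> a1) (\<pi> a2)) a"
  by (simp add: \<pi>_simps sweedler_tensor_map[OF assms])

lemma sweedler2_hom:
  assumes "\<And>b1 b2. bilinear_map sH sH sV (\<lambda>x1 x2. f x1 b1 x2 b2)"
  shows "sweedler2 sV \<Delta>H \<Delta>K f (\<pi> a) b = DKK sV (\<lambda>a1 b1 a2 b2. f (\<pi> a1) b1 (\<pi> a2) b2) a b"
  unfolding sweedler2_def
  by (rule sweedler_comult_hom) (intro bilinear_mapI linear_sweedler_param bilinear_mapD[OF assms])

text \<open>\<open>F\<close> is a coalgebra map on \<open>K \<otimes> K\<close>, being the composite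
  of \<open>\<pi> \<otimes> id\<close> with the module coalgebra action of \<open>H\<close>.\<close>

lemma sweedler_comult_F:
  assumes f: "bilinear_map sK sK sV f"
  shows "DK sV f (F a b) = DKK sV (\<lambda>a1 b1 a2 b2. f (F a1 b1) (F a2 b2)) a b"
  unfolding sweedler_coalgebra_action[OF L.act_coalgebra f]
  by (rule sweedler2_hom) (intro lin linear_bilinear_left[OF f] linear_bilinear_right[OF f])

lemma DKK_swap:
  assumes f: "bilinear_map sK sH sV f"
  shows "DKK sV (\<lambda>a1 b1 a2 b2. f (F a1 b1) (\<pi> a2 \<leftharpoonup> b2)) a b
    = DKK sV (\<lambda>a1 b1 a2 b2. f (F a2 b2) (\<pi> a1 \<leftharpoonup> b1)) a b"
proof -
  note l = linear_bilinear_left[OF f] linear_bilinear_right[OF f]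
  have "sweedler2 sV \<Delta>H \<Delta>K (\<lambda>x1 a1 x2 a2. f (x1 \<rightharpoonup> a1) (x2 \<leftharpoonup> a2)) (\<pi> a) b
    = sweedler2 sV \<Delta>H \<Delta>K (\<lambda>x1 a1 x2 a2. f (x2 \<rightharpoonup> a2) (x1 \<leftharpoonup> a1)) (\<pi> a) b"
    using arg_cong[OF lact_ract_swap, of "sweedler sV f"]
    by (simp add: sweedler2_def sweedler_sweedler_tensor[OF f] sweedler_tensor[OF f])
  then show ?thesis
    by (subst (asm) (1 2) sweedler2_hom) (intro lin l | assumption)+
qed

lemma lact_mult_hom:
  "F a (b * c) = DKK sK (\<lambda>a1 b1 a2 b2. F a1 b1 * ((\<pi> a2 \<leftharpoonup> b2) \<rightharpoonup> c)) a b"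
proof -
  have "F a (b * c) = sweedler2 sK \<Delta>H \<Delta>K (\<lambda>x1 a1 x2 a2. (x1 \<rightharpoonup> a1) * ((x2 \<leftharpoonup> a2) \<rightharpoonup> c)) (\<pi> a) b"
    by (simp add: lact_mult sweedler2_def)
  then show ?thesis
    by (subst (asm) sweedler2_hom) (intro lin | assumption)+
qed

text \<open>The compatibility condition on \<open>\<pi>\<close>, taken at
  \<open>x = \<pi> a\<close>. It writes the product of \<open>\<pi> a\<close> and
  \<open>\<pi> b\<close> as a convolution product whose first factor is \<open>\<pi>\<close> after
  \<open>F\<close>.\<close>

lemma hom_mult_eq:
  "\<pi> a * \<pi> b = DKK sH (\<lambda>a1 b1 a2 b2. \<pi> (F a1 b1) * (\<pi> a2 \<leftharpoonup> b2)) a b"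
proof -
  have "\<pi> a * \<pi> b = sweedler2 sH \<Delta>H \<Delta>K (\<lambda>x1 a1 x2 a2. \<pi> (x1 \<rightharpoonup> a1) * (x2 \<leftharpoonup> a2)) (\<pi> a) b"
    by (simp add: \<pi>_lact_ract sweedler2_def)
  then show ?thesis
    by (subst (asm) sweedler2_hom) (intro lin | assumption)+
qed


section \<open>The convolution inverse of \<open>F\<close> and the equation characterising
  \<open>G\<close>\<close>

text \<open>Coassociativity gathers the two legs seen by \<open>u\<close> under one sum. By
  \<open>e\<close> that sum is a multiple of 1 by counits, and the counit axiom absorbs these into
  the remaining leg.\<close>

lemma convolution_cancel:
  assumes h: "trilinear_map sK sK sK sV h"
    and u: "\<And>b1 b2. bilinear_map sK sK sK (\<lambda>a1 a2. u a1 b1 a2 b2)"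
      "\<And>a1 a2. bilinear_map sK sK sK (\<lambda>b1 b2. u a1 b1 a2 b2)"
    and e: "\<And>a b. DKK sK u a b = sK (\<epsilon>K a * \<epsilon>K b) 1"
  shows "DKK sV (\<lambda>a1 b1 a2 b2. DKK sV (\<lambda>x y z w. h (u a1 b1 x y) z w) a2 b2) a b = h 1 a b"
proof -
  have "DKK sV (\<lambda>a1 b1 a2 b2. DKK sV (\<lambda>x y z w. h (u a1 b1 x y) z w) a2 b2) a b
    = DKK sV (\<lambda>a1 b1 a2 b2. DKK sV (\<lambda>x y z w. h (u x y z w) a2 b2) a1 b1) a b"
    by (rule sweedler2_coassoc[OF coalgK coalgK, symmetric])
      (intro trilinear_mapI linear_comp[OF trilinear_mapD(1)[OF h]] trilinear_mapD(2,3)[OF h]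
        bilinear_mapD[OF u(1)] bilinear_mapD[OF u(2)])+
  also have "\<dots> = DKK sV (\<lambda>a1 b1 a2 b2. h (DKK sK u a1 b1) a2 b2) a b"
    by (simp add: linear_sweedler2[OF trilinear_mapD(1)[OF h]])
  also have "\<dots> = DKK sV (\<lambda>a1 b1 a2 b2. sV (\<epsilon>K a1 * \<epsilon>K b1) (h 1 a2 b2)) a b"
    by (simp add: e linearD(4)[OF trilinear_mapD(1)[OF h]])
  also have "\<dots> = h 1 a b"
    by (rule sweedler2_counit_left[OF coalgK coalgK]) (intro bilinear_mapI trilinear_mapD[OF h])
  finally show ?thesis .
qed

text \<open>The antipode axiom at the element \<open>F a b\<close>, rewritten by means of
  \<open>F\<close> being a coalgebra map: \<open>SK\<close> after \<open>F\<close> is a left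
  convolution inverse of \<open>F\<close>.\<close>

lemma antipode_F_left:
  "DKK sK (\<lambda>a1 b1 a2 b2. SK (F a1 b1) * F a2 b2) a b = sK (\<epsilon>K a * \<epsilon>K b) 1"
proof -
  have "DKK sK (\<lambda>a1 b1 a2 b2. SK (F a1 b1) * F a2 b2) a b = DK sK (\<lambda>p q. SK p * q) (F a b)"
    by (rule sweedler_comult_F[symmetric]) (intro lin)
  then show ?thesis by (simp add: R.B.antipode_left lact_counit \<pi>_simps)
qed

lemma antipode_F_right:
  "DKK sK (\<lambda>a1 b1 a2 b2. F a1 b1 * SK (F a2 b2)) a b = sK (\<epsilon>K a * \<epsilon>K b) 1"
proof -
  have "DKK sK (\<lambda>a1 b1 a2 b2. F a1 b1 * SK (F a2 b2)) a b = DK sK (\<lambda>p q. p * SK q) (F a b)"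
    by (rule sweedler_comult_F[symmetric]) (intro lin)
  then show ?thesis by (simp add: R.B.antipode_right lact_counit \<pi>_simps)
qed

lemma antipode_F_cancel:
  assumes h: "trilinear_map sK sK sK sV h"
  shows "DKK sV (\<lambda>a1 b1 a2 b2. DKK sV (\<lambda>x y z w. h (SK (F a1 b1) * F x y) z w) a2 b2) a b = h 1 a b"
  using h by (rule convolution_cancel) (rule antipode_F_left | intro lin)+

lemma F_antipode_cancel:
  assumes h: "trilinear_map sK sK sK sV h"
  shows "DKK sV (\<lambda>a1 b1 a2 b2. DKK sV (\<lambda>x y z w. h (F a1 b1 * SK (F x y)) z w) a2 b2) a b = h 1 a b"
  using h by (rule convolution_cancel) (rule antipode_F_right | intro lin)+

text \<open>By definition \<open>G\<close> is the convolution product of \<open>SK\<close> after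
  \<open>F\<close> with the multiplication, so convolving with \<open>F\<close> on the left cancels
  the first factor.\<close>

lemma F_G_eq_mult: "DKK sK (\<lambda>a1 b1 a2 b2. F a1 b1 * G a2 b2) a b = a * b"
proof -
  have "F x y * G a b = DKK sK (\<lambda>a1 b1 a2 b2. F x y * SK (F a1 b1) * (a2 * b2)) a b" for x y a b
    unfolding G_eq by (subst linear_sweedler2[where sW = sK and L = "\<lambda>v. F x y * v"])
      (intro lin, simp add: mult.assoc)
  then show ?thesis
    using F_antipode_cancel[of sK "\<lambda>u a b. u * (a * b)" a b] by (simp add: trilinear_mapI lin)
qed

text \<open>In the image of the formula for \<open>G\<close>, the product
  \<open>\<pi> a2 * \<pi> b2\<close> is expanded by \<open>hom_mult_eq\<close>. Multiplicativity of
  \<open>\<pi>\<close> brings \<open>SK (F _ _)\<close> next to \<open>F _ _\<close> inside a single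
  \<open>\<pi>\<close>, where they cancel.\<close>

lemma \<pi>_G: "\<pi> (G a b) = \<pi> a \<leftharpoonup> b"
proof -
  have "\<pi> (G a b) = DKK sH (\<lambda>a1 b1 a2 b2. \<pi> (SK (F a1 b1)) * (\<pi> a2 * \<pi> b2)) a b"
    unfolding G_eq by (simp add: linear_sweedler2[OF \<pi>_linear] \<pi>_simps)
  also have "\<dots> = DKK sH (\<lambda>a1 b1 a2 b2. DKK sH (\<lambda>x y z w. \<pi> (SK (F a1 b1) * F x y) * (\<pi> z \<leftharpoonup> w)) a2 b2) a b"
  proof -
    have "\<pi> u * (\<pi> a * \<pi> b) = DKK sH (\<lambda>x y z w. \<pi> (u * F x y) * (\<pi> z \<leftharpoonup> w)) a b" for u a b
      unfolding hom_mult_eq by (subst linear_sweedler2[where sW = sH and L = "\<lambda>v. \<pi> u * v"])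
        (intro lin, simp add: \<pi>_simps mult.assoc)
    then show ?thesis by simp
  qed
  also have "\<dots> = \<pi> 1 * (\<pi> a \<leftharpoonup> b)"
    by (rule antipode_F_cancel[of sH "\<lambda>u a b. \<pi> u * (\<pi> a \<leftharpoonup> b)"]) (intro lin)
  finally show ?thesis by (simp add: \<pi>_simps)
qed

text \<open>\<open>\<Delta>K 1\<close> is \<open>1 \<otimes> 1\<close>, and \<open>F a1 1\<close> is
  \<open>\<epsilon>K a1\<close> times 1. The counit axiom thus removes the first leg of
  \<open>a\<close>, and only \<open>SK 1\<close> remains to be computed.\<close>

lemma G_one: "G a 1 = a"
proof -
  have "G a 1 = DK sK (\<lambda>a1 a2. DK sK (\<lambda>b1 b2. SK (F a1 b1) * (a2 * b2)) 1) a"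
    by (simp add: G_eq sweedler2_def)
  also have "\<dots> = DK sK (\<lambda>a1 a2. SK (F a1 1) * a2) a"
    by (subst sweedler_comult_one[OF bialgK]) (intro lin, simp)
  also have "\<dots> = DK sK (\<lambda>a1 a2. sK (\<epsilon>K a1) (SK 1 * a2)) a"
    by (simp add: lact_one \<pi>_simps linearD(4)[OF R.B.antipode_linear] R.B.scale_mult_left)
  also have "\<dots> = SK 1 * a"
    by (rule sweedler_counit_left[OF coalgK]) (intro lin)
  also have "SK 1 = 1"
  proof -
    have "DK sK (\<lambda>x1 x2. SK x1 * x2) 1 = SK 1 * 1"
      by (rule sweedler_comult_one[OF bialgK]) (intro lin)
    then show ?thesis by (simp add: R.B.antipode_left R.B.counit_one)
  qed
  finally show ?thesis by simp
qed

section \<open>Compatibility of \<open>G\<close> with the coaction\<close>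

text \<open>With \<open>\<rho> = (\<pi> \<otimes> id) \<Delta>K\<close>, this factors
  \<open>\<rho> (a * b)\<close> as the convolution of \<open>\<rho> (F a b)\<close> with the value
  expected for \<open>\<rho> (G a b)\<close>. The first leg is expanded by
  \<open>hom_mult_eq\<close>, the second by \<open>F_G_eq_mult\<close>.\<close>

lemma hom_comult_mult_decomposition:
  assumes g: "bilinear_map sH sK sV g"
  shows "DKK sV (\<lambda>a1 b1 a2 b2. g (\<pi> a1 * \<pi> b1) (a2 * b2)) a b
    = DKK sV (\<lambda>a1 b1 a2 b2. DKK sV (\<lambda>x y z w.
        DK sV (\<lambda>p q. g (\<pi> p * (\<pi> x \<leftharpoonup> y)) (q * G z w)) (F a1 b1)) a2 b2) a b"
proof -
  note l = linear_bilinear_left[OF g] linear_bilinear_right[OF g]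
  have V: "vector_space sV" using g by (rule bilinear_mapD)
  have "g (\<pi> a1 * \<pi> b1) (a2 * b2) = DKK sV (\<lambda>x y z w. DKK sV (\<lambda>x' y' z' w'.
      g (\<pi> (F x y) * (\<pi> z \<leftharpoonup> w)) (F x' y' * G z' w')) a2 b2) a1 b1" for a1 b1 a2 b2
    unfolding hom_mult_eq F_G_eq_mult[symmetric, of a2 b2]
    by (simp add: linear_sweedler2[OF bilinear_mapD(1)[OF g]] linear_sweedler2[OF bilinear_mapD(2)[OF g]])
      (rule sweedler2_swap[OF V])
  \<comment> \<open>Expanding both arguments of \<open>g\<close> gives the order \<open>F, \<leftharpoonup>, F, G\<close>; regrouping the factors as \<open>1(23)4\<close>
    makes the second and third adjacent, and their exchange turns the two copies of \<open>F\<close> into a coproduct.\<close>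
  then have "DKK sV (\<lambda>a1 b1 a2 b2. g (\<pi> a1 * \<pi> b1) (a2 * b2)) a b
    = DKK sV (\<lambda>a1 b1 a2 b2. DKK sV (\<lambda>x y z w. DKK sV (\<lambda>x' y' z' w'.
        g (\<pi> (F x y) * (\<pi> z \<leftharpoonup> w)) (F x' y' * G z' w')) a2 b2) a1 b1) a b"
    by simp
  also have "\<dots> = DKK sV (\<lambda>a1 b1 a2 b2. DKK sV (\<lambda>x y z w. DKK sV (\<lambda>x' y' z' w'.
        g (\<pi> (F a1 b1) * (\<pi> x \<leftharpoonup> y)) (F x' y' * G z' w')) z w) a2 b2) a b"
    by (rule sweedler2_coassoc[OF coalgK coalgK]) (intro lin l)+
  also have "\<dots> = DKK sV (\<lambda>a1 b1 a2 b2. DKK sV (\<lambda>x y z w. DKK sV (\<lambda>x' y' z' w'.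
        g (\<pi> (F a1 b1) * (\<pi> x' \<leftharpoonup> y')) (F z' w' * G z w)) x y) a2 b2) a b"
    by (subst sweedler2_coassoc[OF coalgK coalgK, symmetric]) (intro lin l | rule refl)+
  also have "\<dots> = DKK sV (\<lambda>a1 b1 a2 b2. DKK sV (\<lambda>x y z w. DKK sV (\<lambda>x' y' z' w'.
        g (\<pi> (F a1 b1) * (\<pi> z' \<leftharpoonup> w')) (F x' y' * G z w)) x y) a2 b2) a b"
    by (subst DKK_swap[where f = "\<lambda>u v. g (\<pi> (F _ _) * v) (u * G _ _)"]) (intro lin l | rule refl)+
  also have "\<dots> = DKK sV (\<lambda>a1 b1 a2 b2. DKK sV (\<lambda>x y z w. DKK sV (\<lambda>x' y' z' w'.
        g (\<pi> (F a1 b1) * (\<pi> x' \<leftharpoonup> y')) (F x y * G z' w')) z w) a2 b2) a b"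
    by (subst sweedler2_coassoc[OF coalgK coalgK]) (intro lin l | rule refl)+
  also have "\<dots> = DKK sV (\<lambda>a1 b1 a2 b2. DKK sV (\<lambda>x y z w. DKK sV (\<lambda>x' y' z' w'.
        g (\<pi> (F x y) * (\<pi> x' \<leftharpoonup> y')) (F z w * G z' w')) a2 b2) a1 b1) a b"
    by (rule sweedler2_coassoc[OF coalgK coalgK, symmetric]) (intro lin l)+
  also have "\<dots> = DKK sV (\<lambda>a1 b1 a2 b2. DKK sV (\<lambda>x' y' z' w'. DKK sV (\<lambda>x y z w.
        g (\<pi> (F x y) * (\<pi> x' \<leftharpoonup> y')) (F z w * G z' w')) a1 b1) a2 b2) a b"
    by (subst sweedler2_swap[OF V]) (rule refl)
  also have "\<dots> = DKK sV (\<lambda>a1 b1 a2 b2. DKK sV (\<lambda>x y z w.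
        DK sV (\<lambda>p q. g (\<pi> p * (\<pi> x \<leftharpoonup> y)) (q * G z w)) (F a1 b1)) a2 b2) a b"
    by (subst sweedler_comult_F) (intro lin l | rule refl)+
  finally show ?thesis .
qed

text \<open>The coaction \<open>\<rho> = (\<pi> \<otimes> id) \<Delta>K\<close> is multiplicative,
  so \<open>\<rho> (G a b)\<close> is the convolution of \<open>\<rho> (SK (F a b))\<close> with
  \<open>\<rho> (a * b)\<close>. The decomposition of the latter begins with
  \<open>\<rho> (F a b)\<close>, which cancels against the antipode factor.\<close>

lemma comult_G:
  assumes g: "bilinear_map sH sK sV g"
  shows "DK sV (\<lambda>p q. g (\<pi> p) q) (G a b) = DKK sV (\<lambda>a1 b1 a2 b2. g (\<pi> a1 \<leftharpoonup> b1) (G a2 b2)) a b"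
proof -
  have V: "vector_space sV" using g by (rule bilinear_mapD)
  note l = linear_bilinear_left[OF g] linear_bilinear_right[OF g]
  \<comment> \<open>\<open>E u v w\<close> is \<open>g\<close> evaluated on \<open>\<rho> u\<close>
    times \<open>v \<otimes> w\<close> in \<open>H \<otimes> K\<close>; no algebra structure on
    tensors has to be set up.\<close>
  define E where "E u v w = DK sV (\<lambda>p q. g (\<pi> p * v) (q * w)) u" for u v w
  have E: "Vector_Spaces.linear sX sV (\<lambda>x. E (k x) v w)" if "Vector_Spaces.linear sX sK k" for sX k v w
    unfolding E_def by (intro lin l that)
  have E': "Vector_Spaces.linear sX sV (\<lambda>x. E u (k x) w)" if "Vector_Spaces.linear sX sH k" for sX k u w
    unfolding E_def by (intro lin l that)
  have E'': "Vector_Spaces.linear sX sV (\<lambda>x. E u v (k x))" if "Vector_Spaces.linear sX sK k" for sX k u v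
    unfolding E_def by (intro lin l that)
  note lE = E E' E''
  have E_one: "E 1 v w = g v w" for v w
    unfolding E_def by (subst sweedler_comult_one[OF bialgK]) (intro lin l, simp add: \<pi>_simps)
  \<comment> \<open>Multiplicativity of \<open>\<rho>\<close>: multiplying by
    \<open>\<rho> (u * u')\<close> means multiplying by \<open>\<rho> u'\<close> first and by
    \<open>\<rho> u\<close> afterwards, from the left.\<close>
  have E_mult: "E (u * u') v w = DK sV (\<lambda>p q. E u (\<pi> p * v) (q * w)) u'" for u u' v w
  proof -
    have "E (u * u') v w = DKK sV (\<lambda>p p' q q'. g (\<pi> (p * p') * v) (q * q' * w)) u u'"
      unfolding E_def by (rule sweedler_comult_mult[OF bialgK]) (intro lin l)
    also have "\<dots> = DK sV (\<lambda>p' q'. DK sV (\<lambda>p q. g (\<pi> (p * p') * v) (q * q' * w)) u) u'"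
      unfolding sweedler2_def by (rule sweedler_swap[OF V])
    finally show ?thesis by (simp add: E_def \<pi>_simps mult.assoc)
  qed
  have E_mult2: "E (u * (a * b)) 1 1 = DKK sV (\<lambda>x y z w. E u (\<pi> x * \<pi> y) (z * w)) a b" for u a b
    unfolding E_mult by (subst sweedler_comult_mult[OF bialgK]) (intro lin lE, simp add: \<pi>_simps)
  have "DK sV (\<lambda>p q. g (\<pi> p) q) (G a b) = E (G a b) 1 1"
    by (simp add: E_def)
  also have "\<dots> = DKK sV (\<lambda>a1 b1 a2 b2. E (SK (F a1 b1) * (a2 * b2)) 1 1) a b"
    unfolding G_eq by (rule linear_sweedler2) (intro lin lE)
  also have "\<dots> = DKK sV (\<lambda>a1 b1 a2 b2. DKK sV (\<lambda>x y z w. E (SK (F a1 b1)) (\<pi> x * \<pi> y) (z * w)) a2 b2) a b"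
    unfolding E_mult2 ..
  also have "\<dots> = DKK sV (\<lambda>a1 b1 a2 b2. DKK sV (\<lambda>x y z w. DKK sV (\<lambda>x' y' z' w'.
      E (SK (F a1 b1) * F x y) (\<pi> x' \<leftharpoonup> y') (G z' w')) z w) a2 b2) a b"
    unfolding E_mult by (subst hom_comult_mult_decomposition) (intro lin lE | rule refl)+
  also have "\<dots> = DKK sV (\<lambda>x' y' z' w'. E 1 (\<pi> x' \<leftharpoonup> y') (G z' w')) a b"
    by (rule antipode_F_cancel[where h = "\<lambda>u a b. DKK sV (\<lambda>x' y' z' w'. E u (\<pi> x' \<leftharpoonup> y') (G z' w')) a b"])
      (intro lin lE)
  finally show ?thesis by (simp add: E_one)
qed

section \<open>Associativity of \<open>G\<close>\<close>

abbreviation DKKK where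
  "DKKK sV f a b c \<equiv> DKK sV (\<lambda>a1 b1 a2 b2. DK sV (\<lambda>c1 c2. f a1 b1 c1 a2 b2 c2) c) a b"

text \<open>Coassociativity of the threefold tensor product coalgebra, handled first in the variable
  \<open>c\<close> and then in the pair \<open>a\<close>, \<open>b\<close>.\<close>

lemma DKKK_coassoc:
  assumes fA: "\<And>b1 c1 b2 c2 b3 c3. trilinear_map sK sK sK sV (\<lambda>a1 a2 a3. f a1 b1 c1 a2 b2 c2 a3 b3 c3)"
    and fB: "\<And>a1 c1 a2 c2 a3 c3. trilinear_map sK sK sK sV (\<lambda>b1 b2 b3. f a1 b1 c1 a2 b2 c2 a3 b3 c3)"
    and fC: "\<And>a1 b1 a2 b2 a3 b3. trilinear_map sK sK sK sV (\<lambda>c1 c2 c3. f a1 b1 c1 a2 b2 c2 a3 b3 c3)"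
  shows "DKKK sV (\<lambda>a1 b1 c1 a2 b2 c2. DKKK sV (\<lambda>x y z x' y' z'. f x y z x' y' z' a2 b2 c2) a1 b1 c1) a b c
    = DKKK sV (\<lambda>a1 b1 c1 a2 b2 c2. DKKK sV (\<lambda>x y z x' y' z'. f a1 b1 c1 x y z x' y' z') a2 b2 c2) a b c"
proof -
  have V: "vector_space sV" using fA by (rule trilinear_mapD)
  have "DKKK sV (\<lambda>a1 b1 c1 a2 b2 c2. DKKK sV (\<lambda>x y z x' y' z'. f x y z x' y' z' a2 b2 c2) a1 b1 c1) a b c
    = DKK sV (\<lambda>a1 b1 a2 b2. DKK sV (\<lambda>x y x' y'.
        DK sV (\<lambda>c1 c2. DK sV (\<lambda>z z'. f x y z x' y' z' a2 b2 c2) c1) c) a1 b1) a b"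
    by (subst sweedler_sweedler2_swap[OF V]) (rule refl)
  also have "\<dots> = DKK sV (\<lambda>a1 b1 a2 b2. DKK sV (\<lambda>x y x' y'.
        DK sV (\<lambda>c1 c2. DK sV (\<lambda>z z'. f x y c1 x' y' z a2 b2 z') c2) c) a1 b1) a b"
    by (subst sweedler_coassoc[OF coalgK fC]) (rule refl)
  also have "\<dots> = DKK sV (\<lambda>a1 b1 a2 b2. DKK sV (\<lambda>x y x' y'.
        DK sV (\<lambda>c1 c2. DK sV (\<lambda>z z'. f a1 b1 c1 x y z x' y' z') c2) c) a2 b2) a b"
    by (rule sweedler2_coassoc[OF coalgK coalgK])
      (intro trilinear_mapI linear_sweedler_param trilinear_mapD[OF fA] trilinear_mapD[OF fB])+
  also have "\<dots> = DKKK sV (\<lambda>a1 b1 c1 a2 b2 c2. DKKK sV (\<lambda>x y z x' y' z'. f a1 b1 c1 x y z x' y' z') a2 b2 c2) a b c"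
    by (subst sweedler_sweedler2_swap[OF V]) (rule refl)
  finally show ?thesis .
qed

lemma DKK_mult_right:
  assumes "\<And>a1 a2. bilinear_map sK sK sV (\<lambda>b1 b2. f a1 b1 a2 b2)"
  shows "DKK sV f a (b * c) = DKKK sV (\<lambda>a1 b1 c1 a2 b2 c2. f a1 (b1 * c1) a2 (b2 * c2)) a b c"
  by (simp add: sweedler2_def[of sV \<Delta>K \<Delta>K f] sweedler_comult_mult[OF bialgK assms])
    (simp add: sweedler2_def)

text \<open>This shows that \<open>G (G a b) c\<close> solves the convolution equation which, by
  invertibility of \<open>F\<close>, determines \<open>G a (b * c)\<close>. The matched pair rule
  for a product splits \<open>F a (b * c)\<close> into two factors, each of which then meets a
  \<open>G\<close>.\<close>

lemma F_mult_G_G: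
  "DKKK sK (\<lambda>a1 b1 c1 a2 b2 c2. F a1 (b1 * c1) * G (G a2 b2) c2) a b c = a * (b * c)"
proof -
  have lm: "DKK sK f a b * v = DKK sK (\<lambda>a1 b1 a2 b2. f a1 b1 a2 b2 * v) a b" for f a b v
    by (rule linear_sweedler2[where L = "\<lambda>u. u * v"]) (intro lin)
  have ml: "v * DKK sK f a b = DKK sK (\<lambda>a1 b1 a2 b2. v * f a1 b1 a2 b2) a b" for f a b v
    by (rule linear_sweedler2[where L = "\<lambda>u. v * u"]) (intro lin)
  have "DKKK sK (\<lambda>a1 b1 c1 a2 b2 c2. F a1 (b1 * c1) * G (G a2 b2) c2) a b c
    = DKK sK (\<lambda>a1 b1 a2 b2. DKK sK (\<lambda>x y z w.
        DK sK (\<lambda>c1 c2. F x y * (((\<pi> z \<leftharpoonup> w) \<rightharpoonup> c1) * G (G a2 b2) c2)) c) a1 b1) a b"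
    unfolding lact_mult_hom lm mult.assoc by (subst sweedler_sweedler2_swap[OF vsK]) (rule refl)
  also have "\<dots> = DKK sK (\<lambda>a1 b1 a2 b2. DKK sK (\<lambda>x y z w.
        DK sK (\<lambda>c1 c2. F a1 b1 * (((\<pi> x \<leftharpoonup> y) \<rightharpoonup> c1) * G (G z w) c2)) c) a2 b2) a b"
    by (rule sweedler2_coassoc[OF coalgK coalgK]) (intro lin)+
  \<comment> \<open>Read from right to left, \<open>comult_G\<close> recognises
    \<open>\<pi> x \<leftharpoonup> y\<close> and \<open>G z w\<close> as the two legs of the
    coaction on a single element \<open>G a2 b2\<close>.\<close>
  also have "\<dots> = DKK sK (\<lambda>a1 b1 a2 b2. DK sK (\<lambda>p q.
        DK sK (\<lambda>c1 c2. F a1 b1 * ((\<pi> p \<rightharpoonup> c1) * G q c2)) c) (G a2 b2)) a b"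
    by (subst comult_G) (intro lin | rule refl)+
  \<comment> \<open>The equation \<open>F_G_eq_mult\<close> applies here to the pair
    \<open>G a2 b2\<close>, \<open>c\<close>, and in the last step to the pair \<open>a\<close>,
    \<open>b\<close>.\<close>
  also have "\<dots> = DKK sK (\<lambda>a1 b1 a2 b2. F a1 b1 * (G a2 b2 * c)) a b"
    unfolding F_G_eq_mult[symmetric, of "G _ _" c] ml by (simp only: sweedler2_def)
  also have "\<dots> = a * (b * c)"
    by (simp add: mult.assoc[symmetric] F_G_eq_mult lm[symmetric])
  finally show ?thesis .
qed

text \<open>In the formula for \<open>G a (b * c)\<close> the triple product is replaced by means of
  \<open>F_mult_G_G\<close>. The antipode factor cancels against \<open>F\<close> at the arguments
  \<open>a\<close> and \<open>b * c\<close>, leaving \<open>G (G a b) c\<close>.\<close>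

lemma G_assoc: "G a (b * c) = G (G a b) c"
proof -
  have "G a (b * c) = DKKK sK (\<lambda>a1 b1 c1 a2 b2 c2. SK (F a1 (b1 * c1)) * (a2 * (b2 * c2))) a b c"
    unfolding G_eq by (rule DKK_mult_right) (intro lin)
  also have "\<dots> = DKKK sK (\<lambda>a1 b1 c1 a2 b2 c2. DKKK sK (\<lambda>x y z x' y' z'.
      SK (F a1 (b1 * c1)) * F x (y * z) * G (G x' y') z') a2 b2 c2) a b c"
  proof -
    have "v * (a * (b * c)) = DKKK sK (\<lambda>x y z x' y' z'. v * F x (y * z) * G (G x' y') z') a b c" for v a b c
      unfolding F_mult_G_G[symmetric, of a b c]
      by (simp add: linear_sweedler2[OF linear_mult(2)[OF algK linear_ident[OF vsK]]]
          linear_sweedler[OF linear_mult(2)[OF algK linear_ident[OF vsK]]] mult.assoc)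
    then show ?thesis by (simp only:)
  qed
  also have "\<dots> = DKKK sK (\<lambda>a1 b1 c1 a2 b2 c2. DKKK sK (\<lambda>x y z x' y' z'.
      SK (F x (y * z)) * F x' (y' * z') * G (G a2 b2) c2) a1 b1 c1) a b c"
    by (rule DKKK_coassoc[symmetric]) (intro lin)+
  also have "\<dots> = DKKK sK (\<lambda>a1 b1 c1 a2 b2 c2.
      DKKK sK (\<lambda>x y z x' y' z'. SK (F x (y * z)) * F x' (y' * z')) a1 b1 c1 * G (G a2 b2) c2) a b c"
    by (simp add: linear_sweedler2[OF linear_mult(1)[OF algK linear_ident[OF vsK]]]
          linear_sweedler[OF linear_mult(1)[OF algK linear_ident[OF vsK]]])
  \<comment> \<open>Since \<open>\<Delta>K\<close> is multiplicative, the inner threefold sum is a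
    twofold one at \<open>a1\<close> and \<open>b1 * c1\<close>, to which
    \<open>antipode_F_left\<close> applies.\<close>
  also have "\<dots> = DKKK sK (\<lambda>a1 b1 c1 a2 b2 c2.
      DKK sK (\<lambda>x y z w. SK (F x y) * F z w) a1 (b1 * c1) * G (G a2 b2) c2) a b c"
    by (subst DKK_mult_right) (intro lin | rule refl)+
  also have "\<dots> = DKKK sK (\<lambda>a1 b1 c1 a2 b2 c2.
      sK (\<epsilon>K a1 * \<epsilon>K b1) (sK (\<epsilon>K c1) (G (G a2 b2) c2))) a b c"
    by (simp add: antipode_F_left R.B.counit_mult R.B.scale_mult_left mult.assoc)
  \<comment> \<open>The counits are absorbed in two rounds, first the one in \<open>c\<close> and
    then those in \<open>a\<close> and \<open>b\<close>.\<close>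
  also have "\<dots> = DKK sK (\<lambda>a1 b1 a2 b2. sK (\<epsilon>K a1 * \<epsilon>K b1) (G (G a2 b2) c)) a b"
    by (subst linear_sweedler[where L = "sK _" and sV = sK, symmetric], intro lin)
      (subst sweedler_counit_left[OF coalgK], (intro lin | rule refl)+)
  also have "\<dots> = G (G a b) c"
    by (rule sweedler2_counit_left[OF coalgK coalgK]) (intro lin)
  finally show ?thesis .
qed

section \<open>The Doi-Hopf module structure on \<open>K\<close> and the morphism\<close>

lemma doi_hopf_module_G:
  "doi_hopf_module sK \<Delta>K \<epsilon>K SK sK \<Delta>K sH \<Delta>H \<epsilon>H ract
    sK (ract_hom sK \<Delta>K SK lact \<pi>) (coact_hom sH sK \<Delta>K \<pi>)"
proof -
  interpret A: left_comodule_algebra sK \<Delta>K \<epsilon>K SK sK \<Delta>K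
    using hopfK by (rule left_comodule_algebra_comult)
  interpret M: left_comodule sH \<Delta>H \<epsilon>H sK "coact_hom sH sK \<Delta>K \<pi>"
    using coalgH coalgK \<pi>_linear by (rule left_comodule_hom) (simp_all add: \<pi>_simps)
  show ?thesis
  proof unfold_locales
    show "right_module sK sK (ract_hom sK \<Delta>K SK lact \<pi>)"
      unfolding right_module_def by (intro conjI allI G_one G_assoc) (intro lin)
    show "coact_hom sH sK \<Delta>K \<pi> (G m a) = sweedler_tensor sH sK (\<lambda>c m0. sweedler_tensor sH sK
        (\<lambda>b a0. tensor sH sK (c \<leftharpoonup> b) (G m0 a0)) (\<Delta>K a)) (coact_hom sH sK \<Delta>K \<pi> m)" for m a
    proof (rule tensor_eqI[OF vsH vsK])
      fix g :: "'h \<Rightarrow> 'k \<Rightarrow> 'f" assume g: "bilinear_map sH sK (*) g"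
      note l = linear_bilinear_left[OF g] linear_bilinear_right[OF g]
      have "sweedler (*) (\<lambda>c m0. DK (*) (\<lambda>b a0. g (c \<leftharpoonup> b) (G m0 a0)) a) (coact_hom sH sK \<Delta>K \<pi> m)
        = DKK (*) (\<lambda>a1 b1 a2 b2. g (\<pi> a1 \<leftharpoonup> b1) (G a2 b2)) m a"
        unfolding coact_hom_def by (subst sweedler_tensor_map) (intro lin l, simp add: sweedler2_def)
      then show "sweedler (*) g (coact_hom sH sK \<Delta>K \<pi> (G m a))
        = sweedler (*) g (sweedler_tensor sH sK (\<lambda>c m0. sweedler_tensor sH sK
            (\<lambda>b a0. tensor sH sK (c \<leftharpoonup> b) (G m0 a0)) (\<Delta>K a)) (coact_hom sH sK \<Delta>K \<pi> m))"
        by (simp add: sweedler_sweedler_tensor[OF g] sweedler_tensor[OF g] comult_G[OF g, symmetric])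
          (simp add: coact_hom_def sweedler_tensor_map[OF g])
    qed (simp_all add: coact_hom_def)
  qed
qed

text \<open>Linearity over \<open>K\<close> is \<open>\<pi>_G\<close>. Colinearity holds because
  applying \<open>\<pi>\<close> to the right leg of the coaction on \<open>K\<close> gives
  \<open>(\<pi> \<otimes> \<pi>) \<Delta>K\<close>, which is \<open>\<Delta>H\<close> after
  \<open>\<pi>\<close>.\<close>

lemma doi_hopf_module_morphism_\<pi>:
  "doi_hopf_module_morphism sK \<Delta>K \<epsilon>K SK sK \<Delta>K sH \<Delta>H \<epsilon>H ract
    sK (ract_hom sK \<Delta>K SK lact \<pi>) (coact_hom sH sK \<Delta>K \<pi>) sH ract \<Delta>H \<pi>"
proof -
  interpret M: doi_hopf_module sK \<Delta>K \<epsilon>K SK sK \<Delta>K sH \<Delta>H \<epsilon>H ract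
    sK "ract_hom sK \<Delta>K SK lact \<pi>" "coact_hom sH sK \<Delta>K \<pi>"
    by (rule doi_hopf_module_G)
  interpret N: doi_hopf_module sK \<Delta>K \<epsilon>K SK sK \<Delta>K sH \<Delta>H \<epsilon>H ract sH ract \<Delta>H
    using R.right_module_coalgebra_axioms by (rule doi_hopf_module_module_coalgebra)
  show ?thesis
  proof unfold_locales
    show "\<Delta>H (\<pi> m) = tensor_map sH sH id \<pi> (coact_hom sH sK \<Delta>K \<pi> m)" for m
    proof (rule tensor_eqI[OF vsH vsH])
      fix g :: "'h \<Rightarrow> 'h \<Rightarrow> 'f" assume g: "bilinear_map sH sH (*) g"
      have "bilinear_map sH sK (*) (\<lambda>x y. g x (\<pi> y))"
        by (intro lin linear_bilinear_left[OF g] linear_bilinear_right[OF g])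
      then show "sweedler (*) g (\<Delta>H (\<pi> m)) = sweedler (*) g (tensor_map sH sH id \<pi> (coact_hom sH sK \<Delta>K \<pi> m))"
        by (simp add: sweedler_comult_hom[OF g] sweedler_tensor_map[OF g] coact_hom_def sweedler_tensor_map)
    qed (simp_all add: \<pi>_simps)
  qed (simp_all add: \<pi>_G linearD[OF \<pi>_linear])
qed

end

theorem theorem5p6:
  fixes sH :: "'f::field \<Rightarrow> 'h::{ring, monoid_mult} \<Rightarrow> 'h"
    and \<Delta>H :: "'h \<Rightarrow> ('f, 'h, 'h) tensor" and \<epsilon>H :: "'h \<Rightarrow> 'f" and SH :: "'h \<Rightarrow> 'h"
    and sK :: "'f \<Rightarrow> 'k::{ring, monoid_mult} \<Rightarrow> 'k"
    and \<Delta>K :: "'k \<Rightarrow> ('f, 'k, 'k) tensor" and \<epsilon>K :: "'k \<Rightarrow> 'f" and SK :: "'k \<Rightarrow> 'k"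
    and lact :: "'h \<Rightarrow> 'k \<Rightarrow> 'k" and ract :: "'h \<Rightarrow> 'k \<Rightarrow> 'h"
    and \<pi> :: "'k \<Rightarrow> 'h"
  assumes "matched_pair sH \<Delta>H \<epsilon>H SH sK \<Delta>K \<epsilon>K SK lact ract"
    and "hopf_algebra_hom sK \<Delta>K \<epsilon>K sH \<Delta>H \<epsilon>H \<pi>"
    and "\<And>x a. sweedler sH (\<lambda>x1 x2. sweedler sH
        (\<lambda>a1 a2. \<pi> (lact x1 a1) * ract x2 a2) (\<Delta>K a)) (\<Delta>H x) = x * \<pi> a"
  shows "doi_hopf_module sK \<Delta>K \<epsilon>K SK  sK \<Delta>K  sH \<Delta>H \<epsilon>H ract  sH ract \<Delta>H
    \<and> doi_hopf_module sK \<Delta>K \<epsilon>K SK  sK \<Delta>K  sH \<Delta>H \<epsilon>H ract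
        sK (ract_hom sK \<Delta>K SK lact \<pi>) (coact_hom sH sK \<Delta>K \<pi>)
    \<and> doi_hopf_module_morphism sK \<Delta>K \<epsilon>K SK  sK \<Delta>K  sH \<Delta>H \<epsilon>H ract
        sK (ract_hom sK \<Delta>K SK lact \<pi>) (coact_hom sH sK \<Delta>K \<pi>)
        sH ract \<Delta>H
        \<pi>"
proof -
  interpret matched_pair_hom sH \<Delta>H \<epsilon>H SH sK \<Delta>K \<epsilon>K SK lact ract \<pi>
    using assms by (simp add: matched_pair_hom_def matched_pair_hom_axioms_def)
  show ?thesis
    using doi_hopf_module_module_coalgebra[OF R.right_module_coalgebra_axioms]
      doi_hopf_module_G doi_hopf_module_morphism_\<pi> by blast
qed

end
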